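(* A simple mixed graph $G$ is uniconnected if and only if $\boldsymbol{\lambda}_1(G)$, the largest eigenvalue of $\mathcal{I}(G)$, is a simple eigenvalue of $\mathcal{I}(G)$ with a positive eigenvector (an eigenvector all of whose entries are positive real numbers).
   Context: A mixed graph $G$ has a finite nonempty vertex set $V_G=\{v_1,\dots,v_n\}$, a finite set $E_G$ of (undirected) edges, each joining an unordered pair of vertices $\{u,v\}$ (a loop if $u=v$), and a finite set $\vec E_G$ of arcs, each going from $u$ to $v$ for an ordered pair $(u,v)$ of vertices (a directed loop if $u=v$); multiple edges, loops, arcs and directed loops are allowed. $G$ is simple if it has no loops, no directed loops, at most one edge joining any two vertices, and at most one arc from $u$ to $v$ for each ordered pair $(u,v)$ (an edge and arcs in both directions may coexist on the same pair of vertices). The integrated adjacency matrix $\mathcal{I}(G)$ is the real symmetric $2n\times 2n$ matrix $\begin{bmatrix}A&D\\ D^T&A\end{bmatrix}$, where $A_{ij}$ ($i\neq j$) is the number of edges joining $v_i$ and $v_j$, $A_{ii}$ is twice the number of loops at $v_i$, and $D_{ij}$ is the number of arcs from $v_i$ to $v_j$. Its eigenvalues are arranged as $\boldsymbol{\lambda}_1(G)\ge\cdots\ge\boldsymbol{\lambda}_{2n}(G)$. A submixed graph of $G$ is given by subsets of the vertices, edges and arcs, with the restricted incidences. The undirected part $G_u$ is the graph with vertex set $V_G$ and edge set $E_G$ (no arcs). The out-degree (in-degree) of $u$ is the number of arcs starting (ending) at $u$. Components are connected components (for mixed graphs, ignoring directions of arcs). A walk in $G$ is a sequence $u_1,e_1,u_2,\dots,e_k,u_{k+1}$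 where each $e_j$ is an edge joining $u_j,u_{j+1}$, or an arc from $u_j$ to $u_{j+1}$ (traversed forward), or an arc from $u_{j+1}$ to $u_j$ (traversed backward). It is closed if $u_1=u_{k+1}$. An alternating walk is a walk containing at least one arc in which, starting from the first arc, successive arcs alternate between forward and backward direction. Numbers of arcs in a walk are counted with repetition. A submixed graph $G'$ of $G$ with at least one arc is a special submixed graph of $G$ if: any two distinct vertices of $G'$ are joined by an alternating walk in $G'$; and if a component $H$ of $G'_u$ has at least one vertex at which some arc of $G'$ ends and at least one vertex at which some arc of $G'$ starts, then for each vertex $v$ of $H$ there is a closed alternating walk in $G'$ starting and ending at $v$ and containing an odd number of arcs. A submixed graph $G'$ of $G$ is a mixed component of $G$ if it is one of: Type I: a component of $G_u$ each of whose vertices has out-degree zero in $G$; Type II: a component of $G_u$ each of whose vertices has in-degree zero in $G$; Type III: a maximal special submixed graph of $G$. In counting mixed components, a component of $G$ with no arcs is counted twice (once as Type I and once as Type II). $G$ is uniconnected if it has exactly one mixed component. *)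

theory Defs
  imports
    "Jordan_Normal_Form.Spectral_Radius"
    "HOL-Library.Uprod"
begin

section \<open>Mixed graphs\<close>

text \<open>Edges and arcs are labels, so that multiple edges and multiple arcs are possible.
  An edge with end points \<open>Upair u u\<close> is a loop; an arc with equal tail and head is a
  directed loop.\<close>

record ('v, 'e, 'a) mixed_graph =
  verts :: "'v set"
  edges :: "'e set"
  ends  :: "'e \<Rightarrow> 'v uprod"
  arcs  :: "'a set"
  tail  :: "'a \<Rightarrow> 'v"
  head  :: "'a \<Rightarrow> 'v"

definition mixed_graph :: "('v, 'e, 'a) mixed_graph \<Rightarrow> bool" where
  "mixed_graph G \<longleftrightarrow>
     finite (verts G) \<and> verts G \<noteq> {} \<and> finite (edges G) \<and> finite (arcs G) \<and>
     (\<forall>e \<in> edges G. set_uprod (ends G e) \<subseteq> verts G) \<and>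
     (\<forall>a \<in> arcs G. tail G a \<in> verts G \<and> head G a \<in> verts G)"

definition simple_mixed_graph :: "('v, 'e, 'a) mixed_graph \<Rightarrow> bool" where
  "simple_mixed_graph G \<longleftrightarrow>
     mixed_graph G \<and>
     (\<forall>e \<in> edges G. \<forall>u. ends G e \<noteq> Upair u u) \<and>
     (\<forall>a \<in> arcs G. tail G a \<noteq> head G a) \<and>
     (\<forall>e \<in> edges G. \<forall>f \<in> edges G. ends G e = ends G f \<longrightarrow> e = f) \<and>
     (\<forall>a \<in> arcs G. \<forall>b \<in> arcs G. tail G a = tail G b \<and> head G a = head G b \<longrightarrow> a = b)"

definition out_degree :: "('v, 'e, 'a) mixed_graph \<Rightarrow> 'v \<Rightarrow> nat" where
  "out_degree G u = card {a \<in> arcs G. tail G a = u}"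

definition in_degree :: "('v, 'e, 'a) mixed_graph \<Rightarrow> 'v \<Rightarrow> nat" where
  "in_degree G u = card {a \<in> arcs G. head G a = u}"

definition undirected_part :: "('v, 'e, 'a) mixed_graph \<Rightarrow> ('v, 'e, 'a) mixed_graph" where
  "undirected_part G = G\<lparr>arcs := {}\<rparr>"

text \<open>The incidence functions are total and are required to be the same functions for a
  submixed graph. So a submixed graph is determined by its sets of vertices, edges and
  arcs, and equality and counting of submixed graphs are those of such triples.\<close>

definition submixed :: "('v, 'e, 'a) mixed_graph \<Rightarrow> ('v, 'e, 'a) mixed_graph \<Rightarrow> bool" where
  "submixed H G \<longleftrightarrow>
     mixed_graph H \<and>
     verts H \<subseteq> verts G \<and> edges H \<subseteq> edges G \<and> arcs H \<subseteq> arcs G \<and>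
     ends H = ends G \<and> tail H = tail G \<and> head H = head G"

definition maximal_submixed ::
  "(('v, 'e, 'a) mixed_graph \<Rightarrow> bool) \<Rightarrow> ('v, 'e, 'a) mixed_graph \<Rightarrow> ('v, 'e, 'a) mixed_graph \<Rightarrow> bool"
  where
  "maximal_submixed P H G \<longleftrightarrow>
     submixed H G \<and> P H \<and> (\<forall>K. submixed K G \<and> P K \<and> submixed H K \<longrightarrow> K = H)"

section \<open>Walks\<close>

text \<open>A walk \<open>u\<^sub>1, e\<^sub>1, u\<^sub>2, \<dots>, e\<^sub>k, u\<^sub>k\<^sub>+\<^sub>1\<close> is given by its first vertex \<open>u\<^sub>1\<close> and the list of
  pairs \<open>(e\<^sub>j, u\<^sub>j\<^sub>+\<^sub>1)\<close>, where each traversed arc is tagged with the direction of traversal.\<close>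

datatype ('e, 'a) step = Edge 'e | Forward 'a | Backward 'a

fun is_step :: "('v, 'e, 'a) mixed_graph \<Rightarrow> 'v \<Rightarrow> ('e, 'a) step \<Rightarrow> 'v \<Rightarrow> bool" where
  "is_step G u (Edge e) w \<longleftrightarrow> e \<in> edges G \<and> ends G e = Upair u w"
| "is_step G u (Forward a) w \<longleftrightarrow> a \<in> arcs G \<and> tail G a = u \<and> head G a = w"
| "is_step G u (Backward a) w \<longleftrightarrow> a \<in> arcs G \<and> tail G a = w \<and> head G a = u"

fun walk :: "('v, 'e, 'a) mixed_graph \<Rightarrow> 'v \<Rightarrow> (('e, 'a) step \<times> 'v) list \<Rightarrow> 'v \<Rightarrow> bool" where
  "walk G u [] v \<longleftrightarrow> u \<in> verts G \<and> u = v"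
| "walk G u ((s, w) # p) v \<longleftrightarrow> u \<in> verts G \<and> is_step G u s w \<and> walk G w p v"

text \<open>The directions of the arcs of a walk, in order and with repetition
  (\<open>True\<close> for forward); edges are skipped.\<close>

fun arc_directions :: "(('e, 'a) step \<times> 'v) list \<Rightarrow> bool list" where
  "arc_directions [] = []"
| "arc_directions ((Edge e, w) # p) = arc_directions p"
| "arc_directions ((Forward a, w) # p) = True # arc_directions p"
| "arc_directions ((Backward a, w) # p) = False # arc_directions p"

definition alternating_walk ::
  "('v, 'e, 'a) mixed_graph \<Rightarrow> 'v \<Rightarrow> (('e, 'a) step \<times> 'v) list \<Rightarrow> 'v \<Rightarrow> bool" where
  "alternating_walk G u p v \<longleftrightarrow>
     walk G u p v \<and> arc_directions p \<noteq> [] \<and> successively (\<noteq>) (arc_directions p)"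

definition connected_mixed :: "('v, 'e, 'a) mixed_graph \<Rightarrow> bool" where
  "connected_mixed G \<longleftrightarrow> (\<forall>u \<in> verts G. \<forall>v \<in> verts G. \<exists>p. walk G u p v)"

definition component :: "('v, 'e, 'a) mixed_graph \<Rightarrow> ('v, 'e, 'a) mixed_graph \<Rightarrow> bool" where
  "component H G \<longleftrightarrow> maximal_submixed connected_mixed H G"

section \<open>Mixed components\<close>

definition special :: "('v, 'e, 'a) mixed_graph \<Rightarrow> bool" where
  "special G \<longleftrightarrow>
     arcs G \<noteq> {} \<and>
     (\<forall>u \<in> verts G. \<forall>v \<in> verts G. u \<noteq> v \<longrightarrow> (\<exists>p. alternating_walk G u p v)) \<and>
     (\<forall>H. component H (undirected_part G) \<longrightarrow>
        (\<exists>a \<in> arcs G. head G a \<in> verts H) \<longrightarrow>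
        (\<exists>a \<in> arcs G. tail G a \<in> verts H) \<longrightarrow>
        (\<forall>v \<in> verts H. \<exists>p. alternating_walk G v p v \<and> odd (length (arc_directions p))))"

definition type_I :: "('v, 'e, 'a) mixed_graph \<Rightarrow> ('v, 'e, 'a) mixed_graph \<Rightarrow> bool" where
  "type_I H G \<longleftrightarrow> component H (undirected_part G) \<and> (\<forall>v \<in> verts H. out_degree G v = 0)"

definition type_II :: "('v, 'e, 'a) mixed_graph \<Rightarrow> ('v, 'e, 'a) mixed_graph \<Rightarrow> bool" where
  "type_II H G \<longleftrightarrow> component H (undirected_part G) \<and> (\<forall>v \<in> verts H. in_degree G v = 0)"

definition type_III :: "('v, 'e, 'a) mixed_graph \<Rightarrow> ('v, 'e, 'a) mixed_graph \<Rightarrow> bool" where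
  "type_III H G \<longleftrightarrow> maximal_submixed special H G"

text \<open>A submixed graph of both type I and type II is the same as a component of \<open>G\<close> without
  arcs; by convention it is counted twice. Type III excludes the other two types, since it
  requires an arc.\<close>

definition num_mixed_components :: "('v, 'e, 'a) mixed_graph \<Rightarrow> nat" where
  "num_mixed_components G =
     card {H. type_I H G} + card {H. type_II H G} + card {H. type_III H G}"

definition uniconnected :: "('v, 'e, 'a) mixed_graph \<Rightarrow> bool" where
  "uniconnected G \<longleftrightarrow> num_mixed_components G = 1"

section \<open>The integrated adjacency matrix\<close>

text \<open>The list \<open>vs\<close> enumerates the vertices, \<open>v\<^sub>i\<close> being \<open>vs ! (i - 1)\<close>.\<close>

definition adj_mat :: "('v, 'e, 'a) mixed_graph \<Rightarrow> 'v list \<Rightarrow> real mat" where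
  "adj_mat G vs = mat (length vs) (length vs) (\<lambda>(i, j).
     (if i = j then 2 else 1) * real (card {e \<in> edges G. ends G e = Upair (vs ! i) (vs ! j)}))"

definition arc_mat :: "('v, 'e, 'a) mixed_graph \<Rightarrow> 'v list \<Rightarrow> real mat" where
  "arc_mat G vs = mat (length vs) (length vs) (\<lambda>(i, j).
     real (card {a \<in> arcs G. tail G a = vs ! i \<and> head G a = vs ! j}))"

definition integrated_adj_mat :: "('v, 'e, 'a) mixed_graph \<Rightarrow> 'v list \<Rightarrow> real mat" where
  "integrated_adj_mat G vs =
     four_block_mat (adj_mat G vs) (arc_mat G vs) (transpose_mat (arc_mat G vs)) (adj_mat G vs)"

definition largest_eigenvalue :: "real mat \<Rightarrow> real" where
  "largest_eigenvalue M = Max (spectrum M)"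

definition simple_eigenvalue :: "real mat \<Rightarrow> real \<Rightarrow> bool" where
  "simple_eigenvalue M k \<longleftrightarrow> eigenvalue M k \<and> order k (char_poly M) = 1"

definition positive_vec :: "real vec \<Rightarrow> bool" where
  "positive_vec x \<longleftrightarrow> (\<forall>i < dim_vec x. 0 < x $ i)"

end

theory Submission
  imports "HOL-Analysis.Function_Topology" Defs
begin

text \<open>The integrated adjacency matrix of \<open>G\<close> is the ordinary adjacency matrix of an undirected graph
  with \<open>2n\<close> vertices, here called the lift of \<open>G\<close>. It has two copies \<open>(v, True)\<close> and \<open>(v, False)\<close> of
  every vertex \<open>v\<close>, two copies of every edge, one on each level, and for every arc from \<open>u\<close> to \<open>w\<close> one
  edge from \<open>(u, True)\<close> to \<open>(w, False)\<close>. A path in the lift changes its level exactly at the arcs, and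
  the level prescribes the direction in which the next arc is traversed; so paths in the lift
  correspond to the walks of \<open>G\<close> whose arcs alternate (\<open>walk_imp_linked\<close>, \<open>linked_imp_walk\<close>).

  The mixed components of \<open>G\<close> are the projections of the connected components of the lift. A component
  without arcs stays on one level and projects to a mixed component of type I or II. A component with
  arcs projects to a special submixed graph (\<open>special_projection\<close>), and every special submixed graph
  is contained in such a projection (\<open>special_le_projection\<close>), so these projections are the maximal
  ones. Hence the number of mixed components is the number of components of the lift
  (\<open>num_mixed_components_eq_card_lift_classes\<close>), and \<open>G\<close> is uniconnected iff its lift is connected, that
  is, iff the integrated adjacency matrix is irreducible.

  What remains is the Perron-Frobenius theorem for symmetric nonnegative matrices and its converse
  (\<open>irreducible_imp_simple_positive\<close>, \<open>irreducible_if_simple_positive\<close>). The largest eigenvalue is the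
  maximum of the quadratic form on the unit sphere, and a maximiser can be taken nonnegative. If the
  matrix is irreducible, a nonnegative solution of the eigenvalue equation with one zero entry is
  zero, which makes the maximiser positive and the eigenspace one-dimensional; the algebraic multiplicity is
  then one because the matrix is symmetric (\<open>symmetric_eigenspace_line_imp_order_one\<close>). If the matrix
  is reducible, a positive eigenvector splits into two independent ones.\<close>

section \<open>The lift of a mixed graph\<close>

text \<open>The end of an arc that sits on level \<open>d\<close> of the lift. Treating tail and head as one function of
  the level lets every argument about out-going arcs serve for in-coming arcs too.\<close>
definition arc_end :: "('v, 'e, 'a) mixed_graph \<Rightarrow> 'a \<Rightarrow> bool \<Rightarrow> 'v" where
  "arc_end G a d = (if d then tail G a else head G a)"

text \<open>The graph whose adjacency matrix is the integrated adjacency matrix: rows of the upper half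
  are the vertices \<open>(v, True)\<close>, rows of the lower half the vertices \<open>(v, False)\<close>.\<close>
definition lift_adj :: "('v, 'e, 'a) mixed_graph \<Rightarrow> 'v \<times> bool \<Rightarrow> 'v \<times> bool \<Rightarrow> bool" where
  "lift_adj G x y \<longleftrightarrow>
     (\<exists>e\<in>edges G. ends G e = Upair (fst x) (fst y) \<and> snd x = snd y) \<or>
     (\<exists>a\<in>arcs G. \<exists>d. x = (arc_end G a d, d) \<and> y = (arc_end G a (\<not> d), \<not> d))"

abbreviation linked :: "('v, 'e, 'a) mixed_graph \<Rightarrow> 'v \<times> bool \<Rightarrow> 'v \<times> bool \<Rightarrow> bool" where
  "linked G \<equiv> (lift_adj G)\<^sup>*\<^sup>*"

definition lift_class :: "('v, 'e, 'a) mixed_graph \<Rightarrow> 'v \<times> bool \<Rightarrow> ('v \<times> bool) set" where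
  "lift_class G x = {y. linked G x y}"

text \<open>The submixed graph covered by a set \<open>C\<close> of vertices of the lift. An edge is kept only if
  one of its two copies has both ends in \<open>C\<close>; its other copy may lie outside \<open>C\<close>, so the lift of
  the projection can be larger than \<open>C\<close>. An arc has a single copy, hence testing its tail suffices
  when \<open>C\<close> is a component.\<close>
definition projection ::
  "('v, 'e, 'a) mixed_graph \<Rightarrow> ('v \<times> bool) set \<Rightarrow> ('v, 'e, 'a) mixed_graph" where
  "projection G C = G\<lparr>verts := fst ` C,
     edges := {e \<in> edges G. \<exists>u w d. ends G e = Upair u w \<and> (u, d) \<in> C \<and> (w, d) \<in> C},
     arcs := {a \<in> arcs G. (tail G a, True) \<in> C}\<rparr>"

lemma projection_simps [simp]:
  "verts (projection G C) = fst ` C"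
  "edges (projection G C) =
     {e \<in> edges G. \<exists>u w d. ends G e = Upair u w \<and> (u, d) \<in> C \<and> (w, d) \<in> C}"
  "arcs (projection G C) = {a \<in> arcs G. (tail G a, True) \<in> C}"
  "ends (projection G C) = ends G" "tail (projection G C) = tail G" "head (projection G C) = head G"
  "arc_end (projection G C) = arc_end G"
  by (auto simp: projection_def arc_end_def fun_eq_iff)

lemma undirected_part_simps [simp]:
  "verts (undirected_part G) = verts G" "edges (undirected_part G) = edges G"
  "arcs (undirected_part G) = {}" "ends (undirected_part G) = ends G"
  "tail (undirected_part G) = tail G" "head (undirected_part G) = head G"
  by (auto simp: undirected_part_def)

lemma mixed_graph_undirected_part: "mixed_graph G \<Longrightarrow> mixed_graph (undirected_part G)"
  by (simp add: mixed_graph_def)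

lemma submixed_undirected_part: "mixed_graph G \<Longrightarrow> submixed (undirected_part G) G"
  by (simp add: submixed_def mixed_graph_def)

lemma submixed_trans: "submixed H K \<Longrightarrow> submixed K G \<Longrightarrow> submixed H G"
  by (auto simp: submixed_def)

lemma submixed_antisym: "submixed H K \<Longrightarrow> submixed K H \<Longrightarrow> H = K"
  by (auto simp: submixed_def intro!: mixed_graph.equality)

lemma lift_adj_sym: "lift_adj G x y \<Longrightarrow> lift_adj G y x"
proof -
  assume xy: "lift_adj G x y"
  then consider e where "e \<in> edges G" "ends G e = Upair (fst y) (fst x)" "snd x = snd y"
    | a d where "a \<in> arcs G" "x = (arc_end G a d, d)" "y = (arc_end G a (\<not> d), \<not> d)"
    unfolding lift_adj_def by (metis Upair_inject)
  then show "lift_adj G y x"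
    unfolding lift_adj_def by cases (auto intro!: exI[of _ "\<not> _"])
qed

lemma linked_sym: "linked G x y \<Longrightarrow> linked G y x"
  by (metis lift_adj_sym sympD sympI symp_rtranclp)

lemma lift_adj_arc: "a \<in> arcs G \<Longrightarrow> lift_adj G (arc_end G a d, d) (arc_end G a (\<not> d), \<not> d)"
  by (auto simp: lift_adj_def)

lemma lift_adj_verts:
  assumes "mixed_graph G" "lift_adj G x y"
  shows "fst x \<in> verts G" "fst y \<in> verts G"
proof -
  have arc: "arc_end G a d \<in> verts G" if "a \<in> arcs G" for a d
    using that assms(1) by (auto simp: mixed_graph_def arc_end_def)
  have edge: "u \<in> verts G \<and> w \<in> verts G" if "e \<in> edges G" "ends G e = Upair u w" for e u w
    using that assms(1) by (force simp: mixed_graph_def)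
  show "fst x \<in> verts G" "fst y \<in> verts G"
    using assms(2) arc edge unfolding lift_adj_def by (metis fst_conv)+
qed

lemma linked_verts: "linked G x y \<Longrightarrow> mixed_graph G \<Longrightarrow> fst x \<in> verts G \<Longrightarrow> fst y \<in> verts G"
  by (induction rule: rtranclp_induct) (auto dest: lift_adj_verts)

lemma lift_adj_submixed: "submixed H G \<Longrightarrow> lift_adj H x y \<Longrightarrow> lift_adj G x y"
  unfolding lift_adj_def submixed_def arc_end_def by (metis subsetD)

lemma linked_submixed: "submixed H G \<Longrightarrow> linked H x y \<Longrightarrow> linked G x y"
  by (metis lift_adj_submixed mono_rtranclp)

lemma lift_class_eq: "linked G x y \<Longrightarrow> lift_class G x = lift_class G y"
  unfolding lift_class_def by (auto intro: rtranclp_trans linked_sym)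

section \<open>Alternating walks are paths of the lift\<close>

text \<open>Fixing the direction of the first arc turns alternation into a condition that passes to
  the tail of a list, and the required next direction is the level reached so far in the lift.\<close>
fun alternates_from :: "bool \<Rightarrow> bool list \<Rightarrow> bool" where
  "alternates_from d [] \<longleftrightarrow> True"
| "alternates_from d (b # bs) \<longleftrightarrow> b = d \<and> alternates_from (\<not> d) bs"

lemma successively_Cons_iff_alternates_from:
  "successively (\<noteq>) (b # bs) \<longleftrightarrow> alternates_from (\<not> b) bs"
proof (induction bs arbitrary: b)
  case (Cons c bs)
  then show ?case by (cases b; cases c) simp_all
qed simp

lemma successively_iff_alternates_from: "successively (\<noteq>) bs \<longleftrightarrow> (\<exists>d. alternates_from d bs)"
proof (cases bs)
  case (Cons b cs)
  then show ?thesis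
    by (simp only: successively_Cons_iff_alternates_from alternates_from.simps) metis
qed simp

lemma alternates_from_append:
  "alternates_from d (bs @ cs) \<longleftrightarrow>
     alternates_from d bs \<and> alternates_from (d = even (length bs)) cs"
proof (induction bs arbitrary: d)
  case (Cons b bs)
  then show ?case by (cases b; cases d) simp_all
qed simp

lemma arc_directions_append: "arc_directions (p @ q) = arc_directions p @ arc_directions q"
  by (induction p rule: arc_directions.induct) auto

lemma walk_append: "walk G u p v \<Longrightarrow> walk G v q w \<Longrightarrow> walk G u (p @ q) w"
  by (induction p arbitrary: u) auto

text \<open>On level \<open>True\<close> of the lift an arc can only be left through its tail, on level \<open>False\<close> only
  through its head, and each arc changes the level. So alternation is exactly what makes a walk
  liftable, and the parity of its number of arcs decides the level where the lifted walk ends.\<close>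
lemma walk_imp_linked:
  "walk G u p v \<Longrightarrow> alternates_from d (arc_directions p) \<Longrightarrow>
     linked G (u, d) (v, d = even (length (arc_directions p)))"
proof (induction p arbitrary: u d rule: arc_directions.induct)
  case (2 e w p)
  then have "lift_adj G (u, d) (w, d)"
    by (auto simp: lift_adj_def)
  with 2 show ?case
    by (auto intro: converse_rtranclp_into_rtranclp)
next
  case (3 a w p)
  then have "lift_adj G (u, True) (w, False)"
    using lift_adj_arc[of a G True] by (auto simp: arc_end_def)
  moreover have "linked G (w, False) (v, False = even (length (arc_directions p)))"
    using 3(1)[of w False] 3(2,3) by auto
  ultimately show ?case
    using 3 by (auto intro: converse_rtranclp_into_rtranclp)
next
  case (4 a w p)
  then have "lift_adj G (u, False) (w, True)"
    using lift_adj_arc[of a G False] by (auto simp: arc_end_def)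
  moreover have "linked G (w, True) (v, True = even (length (arc_directions p)))"
    using 4(1)[of w True] 4(2,3) by auto
  ultimately show ?case
    using 4 by (auto intro: converse_rtranclp_into_rtranclp)
qed auto

lemma walk_with_arc_imp_crossing:
  "walk G u p v \<Longrightarrow> alternates_from d (arc_directions p) \<Longrightarrow> arc_directions p \<noteq> [] \<Longrightarrow>
     \<exists>w. linked G (u, d) (w, \<not> d)"
proof (induction p arbitrary: u d rule: arc_directions.induct)
  case (2 e w p)
  then have "lift_adj G (u, d) (w, d)"
    by (auto simp: lift_adj_def)
  moreover obtain c where "linked G (w, d) (c, \<not> d)"
    using 2 by fastforce
  ultimately show ?case
    by (metis converse_rtranclp_into_rtranclp)
next
  case (3 a w p)
  then have "lift_adj G (u, True) (w, False)"
    using lift_adj_arc[of a G True] by (auto simp: arc_end_def)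
  then show ?case using 3 by auto
next
  case (4 a w p)
  then have "lift_adj G (u, False) (w, True)"
    using lift_adj_arc[of a G False] by (auto simp: arc_end_def)
  then show ?case using 4 by auto
qed auto

lemma linked_imp_walk:
  assumes "linked G (u, d) (v, d')" "mixed_graph G" "u \<in> verts G"
  shows "\<exists>p. walk G u p v \<and> alternates_from d (arc_directions p) \<and>
    d' = (d = even (length (arc_directions p)))"
  using assms
proof (induction rule: converse_rtranclp_induct2)
  case refl
  then have "walk G v [] v" by simp
  then show ?case by (metis alternates_from.simps(1) arc_directions.simps(1) even_zero list.size(3))
next
  case (step u d w c)
  then have w: "w \<in> verts G" using lift_adj_verts by fastforce
  then obtain p where p: "walk G w p v" "alternates_from c (arc_directions p)"
    "d' = (c = even (length (arc_directions p)))"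
    using step by blast
  from step(1) consider e where "e \<in> edges G" "ends G e = Upair u w" "c = d"
    | a where "a \<in> arcs G" "d" "\<not> c" "u = tail G a" "w = head G a"
    | a where "a \<in> arcs G" "\<not> d" "c" "u = head G a" "w = tail G a"
    unfolding lift_adj_def arc_end_def by (cases c; cases d) (auto split: if_splits)
  then show ?case
  proof cases
    case 1
    with p step show ?thesis by (intro exI[of _ "(Edge e, w) # p"]) auto
  next
    case 2
    with p step show ?thesis by (intro exI[of _ "(Forward a, w) # p"]) auto
  next
    case 3
    with p step show ?thesis by (intro exI[of _ "(Backward a, w) # p"]) auto
  qed
qed

text \<open>Both levels meet the component of \<open>x\<close> in the lift, that is, the component contains an arc.\<close>
definition crosses :: "('v, 'e, 'a) mixed_graph \<Rightarrow> 'v \<times> bool \<Rightarrow> bool" where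
  "crosses G x \<longleftrightarrow> snd ` lift_class G x = UNIV"

lemma crosses_iff: "crosses G x \<longleftrightarrow> (\<exists>w. linked G x (w, \<not> snd x))"
proof
  assume "crosses G x"
  then have "(\<not> snd x) \<in> snd ` lift_class G x" by (simp add: crosses_def)
  then show "\<exists>w. linked G x (w, \<not> snd x)" by (auto simp: lift_class_def) 
next
  assume "\<exists>w. linked G x (w, \<not> snd x)"
  then obtain w where "(w, \<not> snd x) \<in> lift_class G x" "x \<in> lift_class G x"
    by (auto simp: lift_class_def)
  then have "{snd x, \<not> snd x} \<subseteq> snd ` lift_class G x" by force
  then show "crosses G x" unfolding crosses_def by (cases "snd x") auto
qed

lemma crosses_linked: "linked G x y \<Longrightarrow> crosses G x \<longleftrightarrow> crosses G y"
  by (simp add: crosses_def lift_class_eq)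

text \<open>A lifted path without arcs is not an alternating walk. If its component contains an arc,
  then the path can be replaced by a detour through a vertex on the other level, and the first
  half of the detour has an odd, hence positive, number of arcs.\<close>
lemma alternating_walk_iff_crosses:
  assumes G: "mixed_graph G" and u: "u \<in> verts G"
  shows "(\<exists>p. alternating_walk G u p v) \<longleftrightarrow> (\<exists>d d'. linked G (u, d) (v, d') \<and> crosses G (u, d))"
proof
  assume "\<exists>p. alternating_walk G u p v"
  then obtain p d where "walk G u p v" "arc_directions p \<noteq> []" "alternates_from d (arc_directions p)"
    unfolding alternating_walk_def successively_iff_alternates_from by auto
  then show "\<exists>d d'. linked G (u, d) (v, d') \<and> crosses G (u, d)"
    using walk_imp_linked walk_with_arc_imp_crossing unfolding crosses_iff by (metis snd_conv)
next
  assume "\<exists>d d'. linked G (u, d) (v, d') \<and> crosses G (u, d)"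
  then obtain d d' w where uv: "linked G (u, d) (v, d')" and uw: "linked G (u, d) (w, \<not> d)"
    by (auto simp: crosses_iff)
  then have "linked G (w, \<not> d) (v, d')"
    by (metis linked_sym rtranclp_trans)
  moreover have "w \<in> verts G" using linked_verts[OF uw G] u by simp
  ultimately obtain q where q: "walk G w q v" "alternates_from (\<not> d) (arc_directions q)"
    using linked_imp_walk G by metis
  obtain p where p: "walk G u p w" "alternates_from d (arc_directions p)"
    "(\<not> d) = (d = even (length (arc_directions p)))"
    using linked_imp_walk[OF uw G u] by metis
  have "arc_directions p \<noteq> []" using p(3) by auto
  moreover have "alternates_from d (arc_directions (p @ q))"
    unfolding arc_directions_append alternates_from_append p(3)[symmetric] using p q by simp
  ultimately have "alternating_walk G u (p @ q) v"
    unfolding alternating_walk_def successively_iff_alternates_from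
    using walk_append[OF p(1) q(1)] by (auto simp: arc_directions_append)
  then show "\<exists>p. alternating_walk G u p v" ..
qed

lemma odd_closed_walk_iff_linked:
  assumes "mixed_graph G" "v \<in> verts G"
  shows "(\<exists>p. alternating_walk G v p v \<and> odd (length (arc_directions p))) \<longleftrightarrow>
    linked G (v, True) (v, False)"
proof
  assume "\<exists>p. alternating_walk G v p v \<and> odd (length (arc_directions p))"
  then obtain p d where p: "walk G v p v" "alternates_from d (arc_directions p)"
    "odd (length (arc_directions p))"
    unfolding alternating_walk_def successively_iff_alternates_from by auto
  then have "linked G (v, d) (v, \<not> d)"
    using walk_imp_linked[OF p(1,2)] by simp
  then show "linked G (v, True) (v, False)"
    by (cases d) (auto intro: linked_sym)
next
  assume "linked G (v, True) (v, False)"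
  then obtain p where p: "walk G v p v" "alternates_from True (arc_directions p)"
    "odd (length (arc_directions p))"
    using linked_imp_walk assms by (metis (full_types))
  then have "arc_directions p \<noteq> []" by auto
  with p have "alternating_walk G v p v"
    unfolding alternating_walk_def successively_iff_alternates_from by blast
  with p show "\<exists>p. alternating_walk G v p v \<and> odd (length (arc_directions p))"
    by blast
qed

section \<open>Components of the undirected part\<close>

text \<open>Without arcs the two levels of the lift are disjoint copies of the same graph.\<close>
lemma linked_no_arcs:
  "linked G x y \<Longrightarrow> arcs G = {} \<Longrightarrow> snd y = snd x \<and> linked G (fst x, d) (fst y, d)"
proof (induction rule: rtranclp_induct)
  case (step y z)
  then have "snd z = snd y" "lift_adj G (fst y, d) (fst z, d)"
    by (auto simp: lift_adj_def)
  with step show ?case by (auto intro: rtranclp.rtrancl_into_rtrancl)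
qed auto

lemma walk_no_arcs: "walk G u p v \<Longrightarrow> arcs G = {} \<Longrightarrow> arc_directions p = []"
  by (induction p arbitrary: u rule: arc_directions.induct) auto

lemma connected_mixed_no_arcs_iff:
  assumes "mixed_graph G" "arcs G = {}"
  shows "connected_mixed G \<longleftrightarrow> (\<forall>u\<in>verts G. \<forall>v\<in>verts G. linked G (u, d) (v, d))"
proof -
  have "(\<exists>p. walk G u p v) \<longleftrightarrow> linked G (u, d) (v, d)" if "u \<in> verts G" for u v
    using linked_imp_walk[OF _ assms(1) that] walk_imp_linked[of G u _ v d] walk_no_arcs[of G u _ v] assms(2)
    by fastforce
  then show ?thesis by (auto simp: connected_mixed_def)
qed

text \<open>A path of the lift never leaves its component, so it uses only edges and arcs that
  the projection of the component keeps.\<close>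
lemma linked_projection:
  assumes "linked G x y"
  shows "linked (projection G (lift_class G x)) x y"
  using assms
proof (induction rule: rtranclp_induct)
  case (step y z)
  have yz: "y \<in> lift_class G x" "z \<in> lift_class G x"
    using step by (auto simp: lift_class_def)
  have "lift_adj (projection G (lift_class G x)) y z"
    using step(2)[unfolded lift_adj_def]
  proof (elim disjE bexE exE conjE)
    fix e assume e: "e \<in> edges G" "ends G e = Upair (fst y) (fst z)" "snd y = snd z"
    have "(fst y, snd y) \<in> lift_class G x" using yz(1) by simp
    moreover have "(fst z, snd y) \<in> lift_class G x" using yz(2) e(3) by simp
    ultimately have "e \<in> edges (projection G (lift_class G x))"
      using e(1,2) unfolding projection_simps by blast
    with e show "lift_adj (projection G (lift_class G x)) y z"
      unfolding lift_adj_def by auto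
  next
    fix a d assume a: "a \<in> arcs G" "y = (arc_end G a d, d)" "z = (arc_end G a (\<not> d), \<not> d)"
    then have "a \<in> arcs (projection G (lift_class G x))"
      using yz by (cases d) (auto simp: arc_end_def)
    with a show "lift_adj (projection G (lift_class G x)) y z"
      unfolding lift_adj_def by auto
  qed
  with step show ?case by (auto intro: rtranclp.rtrancl_into_rtrancl)
qed auto

lemma submixed_projection:
  assumes G: "mixed_graph G" and x: "fst x \<in> verts G"
  shows "submixed (projection G (lift_class G x)) G"
proof -
  let ?C = "lift_class G x"
  have CV: "fst ` ?C \<subseteq> verts G"
    using linked_verts[OF _ G x] by (auto simp: lift_class_def)
  have *: "(head G a, False) \<in> ?C" if "a \<in> arcs G" "(tail G a, True) \<in> ?C" for a
    using that lift_adj_arc[of a G True]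
    by (auto simp: lift_class_def arc_end_def intro: rtranclp.rtrancl_into_rtrancl)
  have "mixed_graph (projection G ?C)"
  proof -
    have "finite (fst ` ?C)"
      using G CV finite_subset unfolding mixed_graph_def by blast
    moreover have "x \<in> ?C" by (simp add: lift_class_def)
    moreover have "tail G a \<in> fst ` ?C \<and> head G a \<in> fst ` ?C"
      if "a \<in> arcs G" "(tail G a, True) \<in> ?C" for a
      using that *[OF that] by force
    moreover have "set_uprod (ends G e) \<subseteq> fst ` ?C"
      if "ends G e = Upair u w" "(u, d) \<in> ?C" "(w, d) \<in> ?C" for e u w d
      using that by force
    ultimately show ?thesis
      using G unfolding mixed_graph_def by auto
  qed
  then show ?thesis using CV by (auto simp: submixed_def)
qed

text \<open>A component of the undirected part is the projection of the component, in the lift of the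
  undirected part, of any of its vertices on any level. This gives both the existence of components
  and a description of their vertices by paths.\<close>
lemma component_undirected_part_iff:
  fixes G :: "('v, 'e, 'a) mixed_graph"
  assumes G: "mixed_graph G"
  shows "component H (undirected_part G) \<longleftrightarrow>
    (\<exists>v\<in>verts G. H = projection (undirected_part G) (lift_class (undirected_part G) (v, d)))"
proof -
  let ?U = "undirected_part G"
  let ?P = "\<lambda>v. projection ?U (lift_class ?U (v, d))"
  have U: "mixed_graph ?U" by (rule mixed_graph_undirected_part[OF G])
  have sub: "submixed (?P v) ?U" if "v \<in> verts G" for v
    using submixed_projection[OF U, of "(v, d)"] that by simp
  have conn: "connected_mixed (?P v)" if v: "v \<in> verts G" for v
  proof -
    have "linked (?P v) (v, d) (u, d)" if "u \<in> verts (?P v)" for u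
      using that linked_projection[of ?U "(v, d)"] linked_no_arcs[of ?U "(v, d)"]
      by (auto simp: lift_class_def)
    then have "\<forall>u\<in>verts (?P v). \<forall>w\<in>verts (?P v). linked (?P v) (u, d) (w, d)"
      by (meson linked_sym rtranclp_trans)
    then show ?thesis
      using connected_mixed_no_arcs_iff[of "?P v" d] sub[OF v] by (simp add: submixed_def)
  qed
  have max: "submixed K (?P v)"
    if K: "submixed K ?U" "connected_mixed K" and v: "v \<in> verts K" for K v
  proof -
    have arcs: "arcs K = {}" and mK: "mixed_graph K"
      using K by (auto simp: submixed_def)
    have lk: "linked ?U (v, d) (u, d)" if "u \<in> verts K" for u
      using connected_mixed_no_arcs_iff[OF mK arcs, of d] K(2) v that linked_submixed[OF K(1)] by blast
    have "e \<in> edges (?P v)" if e: "e \<in> edges K" for e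
    proof -
      obtain u w where uw: "ends G e = Upair u w" by (cases "ends G e") auto
      then have "u \<in> verts K" "w \<in> verts K"
        using mK e K(1) by (auto simp: mixed_graph_def submixed_def)
      then show ?thesis
        using uw e K(1) lk by (auto simp: submixed_def lift_class_def)
    qed
    moreover have "u \<in> verts (?P v)" if "u \<in> verts K" for u
      using lk[OF that] by (force simp: lift_class_def)
    ultimately show ?thesis
      using K arcs mK by (auto simp: submixed_def)
  qed
  have in_P: "v \<in> verts (?P v)" for v
    by (force simp: lift_class_def)
  show ?thesis
  proof
    assume H: "component H ?U"
    then have HU: "submixed H ?U" "connected_mixed H"
      by (auto simp: component_def maximal_submixed_def)
    then have "verts H \<noteq> {}" "verts H \<subseteq> verts G"
      by (simp_all add: submixed_def mixed_graph_def)
    then obtain v where v: "v \<in> verts H" "v \<in> verts G"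
      by blast
    then have "?P v = H"
      using H sub[OF v(2)] conn[OF v(2)] max[OF HU v(1)]
      unfolding component_def maximal_submixed_def by blast
    with v show "\<exists>v\<in>verts G. H = ?P v" by blast
  next
    assume "\<exists>v\<in>verts G. H = ?P v"
    then obtain v where v: "v \<in> verts G" and H: "H = ?P v" by blast
    have "K = H" if K: "submixed K ?U" "connected_mixed K" "submixed H K" for K
    proof -
      have "v \<in> verts K" using in_P[of v] K(3) unfolding H submixed_def by blast
      then have "submixed K H" using max[OF K(1,2)] unfolding H by blast
      with K(3) show ?thesis by (intro submixed_antisym)
    qed
    then show "component H ?U"
      unfolding component_def maximal_submixed_def using sub[OF v] conn[OF v] H by blast
  qed
qed

lemma component_verts_iff:
  assumes G: "mixed_graph G" and H: "component H (undirected_part G)" and v: "v \<in> verts H"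
  shows "w \<in> verts H \<longleftrightarrow> linked (undirected_part G) (v, d) (w, d)"
proof -
  let ?U = "undirected_part G"
  obtain r where r: "H = projection ?U (lift_class ?U (r, d))"
    using component_undirected_part_iff[OF G] H by blast
  have "w \<in> verts H \<longleftrightarrow> linked ?U (r, d) (w, d)" for w
    using linked_no_arcs[of ?U "(r, d)"] unfolding r by (force simp: lift_class_def)
  then show ?thesis using v by (meson linked_sym rtranclp_trans)
qed

lemma ex_component:
  assumes G: "mixed_graph G" and v: "v \<in> verts G"
  obtains H where "component H (undirected_part G)" "v \<in> verts H"
proof
  let ?U = "undirected_part G"
  show "component (projection ?U (lift_class ?U (v, True))) ?U"
    using component_undirected_part_iff[OF G] v by blast
  show "v \<in> verts (projection ?U (lift_class ?U (v, True)))"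
    by (force simp: lift_class_def)
qed

section \<open>Special submixed graphs\<close>

text \<open>Either a path of the lift stays on its level, using edges only, or it reaches an end of
  some arc before it uses an arc.\<close>
lemma linked_cases_first_arc:
  assumes "linked G (v, d) y"
  shows "linked (undirected_part G) (v, d) y \<or>
    (\<exists>a\<in>arcs G. linked (undirected_part G) (v, d) (arc_end G a d, d))"
  using assms
proof (induction rule: rtranclp_induct)
  case (step y z)
  show ?case
  proof (cases "linked (undirected_part G) (v, d) y")
    case True
    then have y: "snd y = d" using linked_no_arcs[of "undirected_part G" "(v, d)" y] by simp
    from step(2) consider "lift_adj (undirected_part G) y z"
      | a where "a \<in> arcs G" "y = (arc_end G a d, d)"
      using y by (auto simp: lift_adj_def)
    then show ?thesis
      using True by cases (auto intro: rtranclp.rtrancl_into_rtrancl)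
  next
    case False
    with step show ?thesis by blast
  qed
qed simp

lemma crosses_iff_arc:
  assumes "mixed_graph G"
  shows "crosses G (v, d) \<longleftrightarrow> (\<exists>a\<in>arcs G. linked (undirected_part G) (v, d) (arc_end G a d, d))"
proof
  assume "crosses G (v, d)"
  then obtain w where "linked G (v, d) (w, \<not> d)" by (auto simp: crosses_iff)
  moreover have "\<not> linked (undirected_part G) (v, d) (w, \<not> d)"
    using linked_no_arcs[of "undirected_part G" "(v, d)" "(w, \<not> d)"] by auto
  ultimately show "\<exists>a\<in>arcs G. linked (undirected_part G) (v, d) (arc_end G a d, d)"
    using linked_cases_first_arc by metis
next
  assume "\<exists>a\<in>arcs G. linked (undirected_part G) (v, d) (arc_end G a d, d)"
  then obtain a where "a \<in> arcs G" "linked (undirected_part G) (v, d) (arc_end G a d, d)" by blast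
  then have "linked G (v, d) (arc_end G a (\<not> d), \<not> d)"
    using linked_submixed[OF submixed_undirected_part[OF assms]] lift_adj_arc
    by (metis rtranclp.rtrancl_into_rtrancl)
  then show "crosses G (v, d)" by (auto simp: crosses_iff)
qed

text \<open>Speciality in terms of the lift: the closed odd walks demanded at a component of the
  undirected part that meets both heads and tails join the two copies of a vertex.\<close>
lemma special_iff:
  assumes K: "mixed_graph K"
  shows "special K \<longleftrightarrow> arcs K \<noteq> {} \<and>
    (\<forall>u\<in>verts K. \<forall>v\<in>verts K. u \<noteq> v \<longrightarrow>
       (\<exists>d d'. linked K (u, d) (v, d') \<and> crosses K (u, d))) \<and>
    (\<forall>v\<in>verts K. crosses K (v, True) \<longrightarrow> crosses K (v, False) \<longrightarrow>
       linked K (v, True) (v, False))"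
proof -
  have crosses_component: "crosses K (v, d) \<longleftrightarrow> (\<exists>a\<in>arcs K. arc_end K a d \<in> verts H)"
    if "component H (undirected_part K)" "v \<in> verts H" for H v d
    using crosses_iff_arc[OF K] component_verts_iff[OF K that] by blast
  have "(\<forall>H. component H (undirected_part K) \<longrightarrow>
        (\<exists>a \<in> arcs K. head K a \<in> verts H) \<longrightarrow> (\<exists>a \<in> arcs K. tail K a \<in> verts H) \<longrightarrow>
        (\<forall>v \<in> verts H. \<exists>p. alternating_walk K v p v \<and> odd (length (arc_directions p))))
     \<longleftrightarrow> (\<forall>v\<in>verts K. crosses K (v, True) \<longrightarrow> crosses K (v, False) \<longrightarrow>
       linked K (v, True) (v, False))" (is "?L \<longleftrightarrow> ?R")
  proof
    assume L: ?L
    show ?R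
    proof (intro ballI impI)
      fix v assume v: "v \<in> verts K" and c: "crosses K (v, True)" "crosses K (v, False)"
      obtain H where H: "component H (undirected_part K)" "v \<in> verts H"
        using ex_component[OF K v] .
      then show "linked K (v, True) (v, False)"
        using L c crosses_component[OF H] odd_closed_walk_iff_linked[OF K v]
        unfolding arc_end_def by auto
    qed
  next
    assume R: ?R
    show ?L
    proof (intro allI impI ballI)
      fix H v
      assume H: "component H (undirected_part K)" and v: "v \<in> verts H"
        and arcs: "\<exists>a \<in> arcs K. head K a \<in> verts H" "\<exists>a \<in> arcs K. tail K a \<in> verts H"
      have vK: "v \<in> verts K"
        using H v by (auto simp: component_def maximal_submixed_def submixed_def)
      have "crosses K (v, True)" "crosses K (v, False)"
        using crosses_component[OF H v] arcs unfolding arc_end_def by auto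
      then show "\<exists>p. alternating_walk K v p v \<and> odd (length (arc_directions p))"
        using R vK odd_closed_walk_iff_linked[OF K vK] by blast
    qed
  qed
  moreover have "(\<forall>u\<in>verts K. \<forall>v\<in>verts K. u \<noteq> v \<longrightarrow> (\<exists>p. alternating_walk K u p v)) \<longleftrightarrow>
    (\<forall>u\<in>verts K. \<forall>v\<in>verts K. u \<noteq> v \<longrightarrow>
       (\<exists>d d'. linked K (u, d) (v, d') \<and> crosses K (u, d)))"
    using alternating_walk_iff_crosses[OF K] by blast
  ultimately show ?thesis
    unfolding special_def by (simp only:)
qed

text \<open>Inside a component \<open>C\<close> of the lift everything is joined by paths of the projection. The only
  danger is a copy \<open>(v, d)\<close> outside \<open>C\<close> of a vertex of the projection; but if its component in the
  lift of the projection contained an arc, then that arc would belong to \<open>C\<close>, and so would \<open>(v, d)\<close>.\<close>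
lemma special_projection:
  assumes G: "mixed_graph G" and x: "fst x \<in> verts G" and crosses: "crosses G x"
  shows "special (projection G (lift_class G x))"
proof -
  let ?C = "lift_class G x" and ?P = "projection G (lift_class G x)"
  have sub: "submixed ?P G" by (rule submixed_projection[OF G x])
  then have P: "mixed_graph ?P" by (simp add: submixed_def)
  have lk: "linked ?P y z" if "y \<in> ?C" "z \<in> ?C" for y z
    using that linked_projection[of G x] by (simp add: lift_class_def) (meson linked_sym rtranclp_trans)
  have arc: "(arc_end G a d, d) \<in> ?C" if "a \<in> arcs ?P" for a d
    using that lift_adj_arc[of a G True]
    by (cases d) (auto simp: lift_class_def arc_end_def intro: rtranclp.rtrancl_into_rtrancl)
  have cr: "crosses ?P y" if "y \<in> ?C" for y
  proof -
    have "(\<not> snd y) \<in> snd ` ?C" using crosses by (simp add: crosses_def)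
    then obtain w where "(w, \<not> snd y) \<in> ?C" by auto
    then show ?thesis using lk[OF that] by (auto simp: crosses_iff)
  qed
  have in_C: "(v, d) \<in> ?C" if cross: "crosses ?P (v, d)" for v d
  proof -
    obtain a where a: "a \<in> arcs ?P" "linked (undirected_part ?P) (v, d) (arc_end G a d, d)"
      using cross unfolding crosses_iff_arc[OF P] projection_simps(7) by blast
    then have "linked G (arc_end G a d, d) (v, d)"
      using linked_submixed submixed_undirected_part[OF P] sub by (metis linked_sym)
    then show ?thesis
      using arc[OF a(1), of d] by (auto simp: lift_class_def intro: rtranclp_trans)
  qed
  have "x \<in> ?C" by (simp add: lift_class_def)
  then have "arcs ?P \<noteq> {}"
    using cr crosses_iff_arc[OF P, of "fst x" "snd x"] by auto
  moreover have "\<exists>d d'. linked ?P (u, d) (v, d') \<and> crosses ?P (u, d)"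
    if "u \<in> verts ?P" "v \<in> verts ?P" for u v
    using that lk cr by (simp, fastforce)
  moreover have "linked ?P (v, True) (v, False)"
    if "crosses ?P (v, True)" "crosses ?P (v, False)" for v
    using that in_C lk by blast
  ultimately show ?thesis
    unfolding special_iff[OF P] by blast
qed

text \<open>Two copies of one vertex are joined by an odd closed walk; copies of distinct vertices are
  joined by lifting an alternating walk on whichever levels it uses and correcting both ends.\<close>
lemma special_crossing_linked:
  assumes mK: "mixed_graph K" and K: "special K"
    and u: "u \<in> verts K" "crosses K (u, d)" and v: "v \<in> verts K" "crosses K (v, d')"
  shows "linked K (u, d) (v, d')"
proof -
  have same: "linked K (w, c) (w, c')" if "w \<in> verts K" "crosses K (w, c)" "crosses K (w, c')" for w c c'
    using that K unfolding special_iff[OF mK]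
    by (cases c; cases c') (auto intro: linked_sym)
  show ?thesis
  proof (cases "u = v")
    case True
    then show ?thesis using same u v by blast
  next
    case False
    then obtain e e' where e: "linked K (u, e) (v, e')" "crosses K (u, e)"
      using K u v unfolding special_iff[OF mK] by blast
    then have "crosses K (v, e')" using crosses_linked by blast
    then show ?thesis
      using e same[OF u(1,2) e(2)] same[OF v(1) _ v(2)] by (meson rtranclp_trans)
  qed
qed

text \<open>All arcs of a special submixed graph lie in one component of the lift, and every vertex
  has a copy in the component of an arc. Hence the special submixed graph is contained in the
  projection of that component.\<close>
lemma special_le_projection:
  assumes G: "mixed_graph G" and sub: "submixed K G" and K: "special K"
  obtains x where "fst x \<in> verts G" "crosses G x" "submixed K (projection G (lift_class G x))"
proof -
  have mK: "mixed_graph K" using sub by (simp add: submixed_def)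
  have arc_crosses: "crosses K (arc_end K b d, d)" if "b \<in> arcs K" for b d
    using that crosses_iff_arc[OF mK] by blast
  obtain a where a: "a \<in> arcs K" using K by (auto simp: special_def)
  define x where "x = (tail K a, True)"
  have xK: "fst x \<in> verts K" "crosses K x"
    using a mK arc_crosses[OF a, of True] by (auto simp: x_def mixed_graph_def arc_end_def)
  have in_C: "(v, d) \<in> lift_class G x" if "v \<in> verts K" "crosses K (v, d)" for v d
    using special_crossing_linked[OF mK K, of "tail K a" True v d] that xK linked_submixed[OF sub]
    by (simp add: x_def lift_class_def)
  have ex_crosses: "\<exists>d. crosses K (v, d)" if v: "v \<in> verts K" for v
  proof (cases "v = fst x")
    case True
    then show ?thesis using xK by (auto simp: x_def)
  next
    case False
    then show ?thesis using K v xK(1) unfolding special_iff[OF mK] by blast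
  qed
  let ?P = "projection G (lift_class G x)"
  have "verts K \<subseteq> verts ?P"
    using in_C ex_crosses by force
  moreover have "edges K \<subseteq> edges ?P"
  proof
    fix e assume e: "e \<in> edges K"
    obtain u w where uw: "ends G e = Upair u w" by (cases "ends G e") auto
    have "u \<in> verts K" "w \<in> verts K"
      using mK e sub uw by (auto simp: mixed_graph_def submixed_def)
    moreover obtain d where "crosses K (u, d)"
      using ex_crosses \<open>u \<in> verts K\<close> by blast
    moreover have "lift_adj K (u, d) (w, d)"
      using e uw sub by (auto simp: lift_adj_def submixed_def)
    ultimately have "(u, d) \<in> lift_class G x" "(w, d) \<in> lift_class G x"
      using in_C crosses_linked by (blast intro: r_into_rtranclp)+
    then show "e \<in> edges ?P"
      using e uw sub by (auto simp: submixed_def)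
  qed
  moreover have "arcs K \<subseteq> arcs ?P"
  proof
    fix b assume b: "b \<in> arcs K"
    then have "(tail K b, True) \<in> lift_class G x"
      using in_C arc_crosses[OF b, of True] mK by (auto simp: arc_end_def mixed_graph_def)
    then show "b \<in> arcs ?P"
      using b sub by (auto simp: submixed_def)
  qed
  ultimately have "submixed K ?P"
    using sub by (auto simp: submixed_def)
  moreover have "fst x \<in> verts G" using xK sub by (auto simp: submixed_def)
  moreover have "crosses G x"
    using xK(2) linked_submixed[OF sub] unfolding crosses_iff by blast
  ultimately show thesis using that by blast
qed

section \<open>Counting mixed components\<close>

definition lift_classes :: "('v, 'e, 'a) mixed_graph \<Rightarrow> ('v \<times> bool) set set" where
  "lift_classes G = lift_class G ` (verts G \<times> UNIV)"

lemma lift_classes_eqI: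
  assumes "C \<in> lift_classes G" "D \<in> lift_classes G" "x \<in> C" "x \<in> D"
  shows "C = D"
  using assms lift_class_eq unfolding lift_classes_def lift_class_def by (smt (verit) imageE mem_Collect_eq)

text \<open>Projections of components with an arc are special, every special submixed graph lies
  below one of them, and they are pairwise incomparable because an arc belongs to a single component.
  So they are the maximal special submixed graphs.\<close>
lemma bij_betw_projection_type_III:
  assumes G: "mixed_graph G"
  shows "bij_betw (projection G) {C \<in> lift_classes G. snd ` C = UNIV} {H. type_III H G}"
proof (rule bij_betw_imageI)
  let ?A = "{C \<in> lift_classes G. snd ` C = UNIV}"
  have ex_arc: "arcs (projection G C) \<noteq> {}" if C: "C \<in> ?A" for C
  proof -
    obtain x where "fst x \<in> verts G" "C = lift_class G x" "crosses G x"
      using C by (auto simp: lift_classes_def crosses_def)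
    then show ?thesis
      using special_projection[OF G, of x] unfolding special_def by simp
  qed
  have inj: "C = D" if C: "C \<in> ?A" and D: "D \<in> ?A" and
    sub: "submixed (projection G C) (projection G D)" for C D
  proof -
    obtain a where a: "a \<in> arcs (projection G C)" using ex_arc[OF C] by blast
    moreover have "a \<in> arcs (projection G D)" using a sub unfolding submixed_def by blast
    ultimately show ?thesis
      using C D by (intro lift_classes_eqI[of C G D "(tail G a, True)"]) auto
  qed
  have proj: "submixed (projection G C) G" "special (projection G C)" if "C \<in> ?A" for C
    using that submixed_projection[OF G] special_projection[OF G]
    by (auto simp: lift_classes_def crosses_def)
  have ge: "\<exists>C\<in>?A. submixed K (projection G C)" if K: "submixed K G" "special K" for K
  proof -
    obtain x where "fst x \<in> verts G" "crosses G x" "submixed K (projection G (lift_class G x))"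
      using special_le_projection[OF G K] .
    then show ?thesis
      by (intro bexI[of _ "lift_class G x"]) (auto simp: lift_classes_def crosses_def mem_Times_iff)
  qed
  have submixed_refl: "submixed H H" if "submixed H G" for H
    using that by (auto simp: submixed_def)
  show "inj_on (projection G) ?A"
  proof (rule inj_onI)
    fix C D assume CD: "C \<in> ?A" "D \<in> ?A" "projection G C = projection G D"
    then have "submixed (projection G C) (projection G D)"
      using submixed_refl[OF proj(1)[OF CD(1)]] by simp
    then show "C = D" using inj CD by blast
  qed
  show "projection G ` ?A = {H. type_III H G}"
  proof (rule subset_antisym; rule subsetI)
    fix H assume "H \<in> projection G ` ?A"
    then obtain C where C: "C \<in> ?A" "H = projection G C" by blast
    have "K = H" if K: "submixed K G" "special K" "submixed H K" for K
    proof -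
      obtain D where D: "D \<in> ?A" "submixed K (projection G D)"
        using ge[OF K(1,2)] by blast
      then have "C = D"
        using inj[OF C(1) D(1)] K(3) C(2) submixed_trans by blast
      then show ?thesis using D K(3) C(2) by (intro submixed_antisym) auto
    qed
    then show "H \<in> {H. type_III H G}"
      using proj[OF C(1)] C(2) by (auto simp: type_III_def maximal_submixed_def)
  next
    fix H assume "H \<in> {H. type_III H G}"
    then have H: "submixed H G" "special H"
      and max: "\<And>K. submixed K G \<Longrightarrow> special K \<Longrightarrow> submixed H K \<Longrightarrow> K = H"
      by (auto simp: type_III_def maximal_submixed_def)
    obtain C where "C \<in> ?A" "submixed H (projection G C)"
      using ge[OF H] by blast
    then show "H \<in> projection G ` ?A"
      using max[of "projection G C"] proj by blast
  qed
qed

lemma lift_class_one_level_iff: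
  assumes G: "mixed_graph G"
  shows "snd ` lift_class G (v, d) = {d} \<longleftrightarrow> \<not> crosses G (v, d)"
proof -
  have "(v, d) \<in> lift_class G (v, d)" by (simp add: lift_class_def)
  then have d: "d \<in> snd ` lift_class G (v, d)" by force
  have "snd ` lift_class G (v, d) = {d}" if "\<not> crosses G (v, d)"
  proof (rule subset_antisym)
    show "snd ` lift_class G (v, d) \<subseteq> {d}"
    proof
      fix c assume "c \<in> snd ` lift_class G (v, d)"
      then obtain w where "linked G (v, d) (w, c)" by (auto simp: lift_class_def)
      then show "c \<in> {d}"
        using that by (cases "c = d") (auto simp: crosses_iff)
    qed
  qed (use d in blast)
  moreover have "(UNIV :: bool set) \<noteq> {d}"
    by (cases d) (auto simp: UNIV_bool)
  ultimately show ?thesis unfolding crosses_def by metis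
qed

text \<open>A component of the lift without arcs is a copy of a component of the undirected part.\<close>
lemma projection_one_level:
  assumes G: "mixed_graph G" and v: "\<not> crosses G (v, d)"
  shows "projection G (lift_class G (v, d)) =
    projection (undirected_part G) (lift_class (undirected_part G) (v, d))"
proof -
  let ?C = "lift_class G (v, d)"
  have "linked (undirected_part G) (v, d) y" if "linked G (v, d) y" for y
    using linked_cases_first_arc[OF that] v crosses_iff_arc[OF G] by blast
  then have eq: "?C = lift_class (undirected_part G) (v, d)"
    using linked_submixed[OF submixed_undirected_part[OF G]] by (auto simp: lift_class_def)
  have "a \<notin> arcs (projection G ?C)" for a
  proof
    assume a: "a \<in> arcs (projection G ?C)"
    then have "(tail G a, True) \<in> ?C" "(head G a, False) \<in> ?C"
      using lift_adj_arc[of a G True]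
      by (auto simp: lift_class_def arc_end_def intro: rtranclp.rtrancl_into_rtrancl)
    then have "snd (tail G a, True) \<in> snd ` ?C" "snd (head G a, False) \<in> snd ` ?C"
      by (blast intro: imageI)+
    then show False using v lift_class_one_level_iff[OF G, of v d] by (cases d) auto
  qed
  then have "arcs (projection G ?C) = {}" by blast
  then show ?thesis
    unfolding eq[symmetric] by (intro mixed_graph.equality) auto
qed

text \<open>For \<open>d = True\<close> these are the mixed components of type I, for \<open>d = False\<close> those of type II:
  copies on level \<open>d\<close> of components of the undirected part that contain no level-\<open>d\<close> end of an arc.\<close>
lemma bij_betw_projection_one_level:
  fixes G :: "('v, 'e, 'a) mixed_graph"
  assumes G: "mixed_graph G"
  shows "bij_betw (projection G) {C \<in> lift_classes G. snd ` C = {d}}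
    {H. component H (undirected_part G) \<and> (\<forall>v\<in>verts H. \<forall>a\<in>arcs G. arc_end G a d \<noteq> v)}"
    (is "bij_betw _ ?A ?B")
proof (rule bij_betw_imageI)
  let ?U = "undirected_part G"
  have A_iff: "C \<in> ?A \<longleftrightarrow> (\<exists>v\<in>verts G. C = lift_class G (v, d) \<and> \<not> crosses G (v, d))" for C
  proof
    assume C: "C \<in> ?A"
    then obtain x where x: "fst x \<in> verts G" "C = lift_class G x"
      by (auto simp: lift_classes_def)
    then have "x \<in> C" by (simp add: lift_class_def)
    then have "snd x = d" using C by blast
    then have "x = (fst x, d)" by (cases x) simp
    then have "C = lift_class G (fst x, d)" using x(2) by simp
    then show "\<exists>v\<in>verts G. C = lift_class G (v, d) \<and> \<not> crosses G (v, d)"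
      using x(1) C lift_class_one_level_iff[OF G, of "fst x" d] by blast
  next
    assume "\<exists>v\<in>verts G. C = lift_class G (v, d) \<and> \<not> crosses G (v, d)"
    then show "C \<in> ?A"
      using lift_class_one_level_iff[OF G, of _ d] unfolding lift_classes_def by blast
  qed
  have comp_iff: "component H ?U \<and> (\<forall>w\<in>verts H. \<forall>a\<in>arcs G. arc_end G a d \<noteq> w) \<longleftrightarrow>
      component H ?U \<and> \<not> crosses G (v, d)" if "v \<in> verts H" for H v
    using component_verts_iff[OF G _ that, of _ d] crosses_iff_arc[OF G, of v d] by blast
  have in_P: "v \<in> verts (projection ?U (lift_class ?U (v, d)))" for v
    by (force simp: lift_class_def)
  have B_iff: "H \<in> ?B \<longleftrightarrow> (\<exists>v\<in>verts G. H = projection ?U (lift_class ?U (v, d)) \<and> \<not> crosses G (v, d))" for H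
    using component_undirected_part_iff[OF G, of H d] comp_iff in_P by blast
  show "inj_on (projection G) ?A"
  proof (rule inj_onI)
    fix C D assume CD: "C \<in> ?A" "D \<in> ?A" "projection G C = projection G D"
    have level: "E = fst ` E \<times> {d}" if "snd ` E = {d}" for E :: "('v \<times> bool) set"
    proof -
      have "x = (fst x, d)" if "x \<in> E" for x
        using \<open>snd ` E = {d}\<close> imageI[OF that, of snd] by (simp add: prod_eq_iff)
      then show ?thesis by fastforce
    qed
    have "snd ` C = {d}" "snd ` D = {d}" using CD(1,2) by simp_all
    then have "C = fst ` C \<times> {d}" "D = fst ` D \<times> {d}"
      using level by metis+
    moreover have "fst ` C = fst ` D"
      using arg_cong[OF CD(3), of verts] by simp
    ultimately show "C = D" by metis
  qed
  show "projection G ` ?A = ?B"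
  proof (rule subset_antisym; rule subsetI)
    fix H assume "H \<in> projection G ` ?A"
    then obtain C where "C \<in> ?A" and H: "H = projection G C" by (rule imageE)
    then obtain v where "v \<in> verts G" "C = lift_class G (v, d)" "\<not> crosses G (v, d)"
      unfolding A_iff by blast
    then show "H \<in> ?B"
      unfolding B_iff H using projection_one_level[OF G] by blast
  next
    fix H assume "H \<in> ?B"
    then obtain v where v: "v \<in> verts G" "\<not> crosses G (v, d)"
      and H: "H = projection ?U (lift_class ?U (v, d))"
      unfolding B_iff by blast
    then have "lift_class G (v, d) \<in> ?A"
      unfolding A_iff by blast
    then show "H \<in> projection G ` ?A"
      unfolding H projection_one_level[OF G v(2), symmetric] by (rule imageI)
  qed
qed

text \<open>The levels that a component of the lift meets are \<open>{True}\<close>, \<open>{False}\<close> or both, which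
  matches the three types. An arcless component of the graph has two copies in the lift, in
  agreement with its being counted twice.\<close>
lemma num_mixed_components_eq_card_lift_classes:
  assumes G: "mixed_graph G"
  shows "num_mixed_components G = card (lift_classes G)"
proof -
  let ?A = "\<lambda>S. {C \<in> lift_classes G. snd ` C = S}"
  have out: "out_degree G v = 0 \<longleftrightarrow> (\<forall>a\<in>arcs G. arc_end G a True \<noteq> v)" for v
    using G by (auto simp: out_degree_def arc_end_def mixed_graph_def)
  have in': "in_degree G v = 0 \<longleftrightarrow> (\<forall>a\<in>arcs G. arc_end G a False \<noteq> v)" for v
    using G by (auto simp: in_degree_def arc_end_def mixed_graph_def)
  have "card {H. type_I H G} = card (?A {True})"
    using bij_betw_same_card[OF bij_betw_projection_one_level[OF G, of True]]
    by (simp add: type_I_def out)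
  moreover have "card {H. type_II H G} = card (?A {False})"
    using bij_betw_same_card[OF bij_betw_projection_one_level[OF G, of False]]
    by (simp add: type_II_def in')
  moreover have "card {H. type_III H G} = card (?A UNIV)"
    using bij_betw_same_card[OF bij_betw_projection_type_III[OF G]] by simp
  moreover have "finite (lift_classes G)"
    using G by (simp add: lift_classes_def mixed_graph_def)
  moreover have "lift_classes G = ?A {True} \<union> ?A {False} \<union> ?A UNIV"
  proof -
    have "snd ` C \<in> {{True}, {False}, UNIV}" if "C \<in> lift_classes G" for C
    proof -
      have "snd ` C \<noteq> {}" using that by (auto simp: lift_classes_def lift_class_def)
      then show ?thesis unfolding UNIV_bool by (smt (verit, best) all_not_in_conv insert_iff set_eq_iff)
    qed
    then show ?thesis by auto
  qed
  moreover have "card (?A {True} \<union> ?A {False} \<union> ?A UNIV)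
      = card (?A {True}) + card (?A {False}) + card (?A UNIV)"
  proof -
    have "?A {True} \<inter> ?A {False} = {}" "(?A {True} \<union> ?A {False}) \<inter> ?A UNIV = {}"
      by (auto simp: UNIV_bool)
    then show ?thesis
      using \<open>finite (lift_classes G)\<close> by (simp add: card_Un_disjoint)
  qed
  ultimately show ?thesis
    unfolding num_mixed_components_def by simp
qed

text \<open>Connectedness of the lift, phrased by closed sets so that it can be compared with
  irreducibility of a matrix without talking about paths between indices.\<close>
lemma uniconnected_iff_no_closed_set:
  assumes G: "mixed_graph G"
  shows "uniconnected G \<longleftrightarrow>
    (\<forall>S \<subseteq> verts G \<times> UNIV. S \<noteq> {} \<longrightarrow> (\<forall>x\<in>S. \<forall>y. lift_adj G x y \<longrightarrow> y \<in> S) \<longrightarrow>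
       S = verts G \<times> UNIV)"
proof -
  have "uniconnected G \<longleftrightarrow> card (lift_classes G) = 1"
    by (simp add: uniconnected_def num_mixed_components_eq_card_lift_classes[OF G])
  also have "\<dots> \<longleftrightarrow> lift_classes G = {verts G \<times> UNIV}"
  proof
    assume "card (lift_classes G) = 1"
    then obtain C where C: "lift_classes G = {C}" by (auto simp: card_1_singleton_iff)
    have "x \<in> C" if "x \<in> verts G \<times> UNIV" for x
    proof -
      have "lift_class G x \<in> lift_classes G" using that by (auto simp: lift_classes_def)
      then have "lift_class G x = C" by (simp add: C)
      then show ?thesis by (auto simp: lift_class_def)
    qed
    moreover have "C \<in> lift_classes G" by (simp add: C)
    then have "C \<subseteq> verts G \<times> UNIV"
      using linked_verts[OF _ G] unfolding lift_classes_def lift_class_def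
      by (force simp: mem_Times_iff)
    ultimately have "C = verts G \<times> UNIV" by blast
    with C show "lift_classes G = {verts G \<times> UNIV}" by simp
  qed simp
  also have "\<dots> \<longleftrightarrow> (\<forall>S \<subseteq> verts G \<times> UNIV. S \<noteq> {} \<longrightarrow>
      (\<forall>x\<in>S. \<forall>y. lift_adj G x y \<longrightarrow> y \<in> S) \<longrightarrow> S = verts G \<times> UNIV)" (is "?L \<longleftrightarrow> ?R")
  proof
    assume L: ?L
    show ?R
    proof (intro allI impI)
      fix S assume S: "S \<subseteq> verts G \<times> (UNIV :: bool set)" "S \<noteq> {}"
        and closed: "\<forall>x\<in>S. \<forall>y. lift_adj G x y \<longrightarrow> y \<in> S"
      obtain x where x: "x \<in> S" using S by blast
      have "y \<in> S" if "linked G x y" for y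
        using that by (induction rule: rtranclp_induct) (use x closed in auto)
      then have "lift_class G x \<subseteq> S" by (auto simp: lift_class_def)
      moreover have "lift_class G x \<in> lift_classes G"
        using x S by (auto simp: lift_classes_def)
      ultimately show "S = verts G \<times> UNIV" using L S by auto
    qed
  next
    assume R: ?R
    have "lift_class G x = verts G \<times> UNIV" if "x \<in> verts G \<times> UNIV" for x
    proof -
      have "lift_class G x \<subseteq> verts G \<times> UNIV"
        using linked_verts[OF _ G, of x] that by (auto simp: lift_class_def mem_Times_iff)
      moreover have "x \<in> lift_class G x" by (simp add: lift_class_def)
      moreover have "\<forall>y\<in>lift_class G x. \<forall>z. lift_adj G y z \<longrightarrow> z \<in> lift_class G x"
        by (auto simp: lift_class_def intro: rtranclp.rtrancl_into_rtrancl)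
      ultimately show ?thesis using R by blast
    qed
    moreover have "verts G \<noteq> {}" using G by (simp add: mixed_graph_def)
    ultimately show ?L unfolding lift_classes_def by (simp add: image_constant_conv)
  qed
  finally show ?thesis .
qed

section \<open>Maximising the quadratic form\<close>

text \<open>No proper nonempty set of indices is closed under the nonzero entries: the graph of the
  nonzero entries is strongly connected.\<close>
definition irreducible_mat :: "real mat \<Rightarrow> bool" where
  "irreducible_mat M \<longleftrightarrow>
     (\<forall>S \<subseteq> {..<dim_row M}. S \<noteq> {} \<longrightarrow>
        (\<forall>i\<in>S. \<forall>j<dim_row M. M $$ (i, j) \<noteq> 0 \<longrightarrow> j \<in> S) \<longrightarrow> S = {..<dim_row M})"

definition quad_form :: "real mat \<Rightarrow> (nat \<Rightarrow> real) \<Rightarrow> real" where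
  "quad_form M f = (\<Sum>i<dim_row M. \<Sum>j<dim_row M. M $$ (i, j) * f i * f j)"

lemma mult_mat_vec_index:
  assumes "M \<in> carrier_mat n n" "x \<in> carrier_vec n" "i < n"
  shows "(M *\<^sub>v x) $ i = (\<Sum>j<n. M $$ (i, j) * x $ j)"
  using assms by (simp add: scalar_prod_def atLeast0LessThan)

lemma quad_form_scale: "quad_form M (\<lambda>i. c * f i) = c\<^sup>2 * quad_form M f"
  by (simp add: quad_form_def sum_distrib_left power2_eq_square mult_ac)

lemma continuous_on_quad_form: "continuous_on A (quad_form M)"
  unfolding quad_form_def
  by (intro continuous_intros continuous_on_subset[OF continuous_on_product_coordinates]) auto

text \<open>The unit sphere of \<open>\<real>\<^sup>n\<close> is realised inside the functions on \<open>\<nat>\<close> that vanish from \<open>n\<close> on, where it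
  is compact by Tychonoff's theorem; a continuous function on it attains its maximum, and the
  inequality for all \<open>g\<close> follows by scaling.\<close>
lemma rayleigh_maximizer:
  assumes n: "dim_row M > 0"
  obtains f where "(\<Sum>i<dim_row M. (f i)\<^sup>2) = 1"
    and "\<And>g. quad_form M g \<le> quad_form M f * (\<Sum>i<dim_row M. (g i)\<^sup>2)"
proof -
  let ?n = "dim_row M"
  define B where "B = (\<Pi>\<^sub>E i\<in>UNIV. if i < ?n then {-1..1::real} else {0})"
  define S where "S = B \<inter> {f. (\<Sum>i<?n. (f i)\<^sup>2) = 1}"
  have "compact B"
    unfolding B_def compactin_euclidean_iff[symmetric] euclidean_product_topology[symmetric]
    by (subst compactin_PiE) auto
  moreover have "closed {f :: nat \<Rightarrow> real. (\<Sum>i<?n. (f i)\<^sup>2) = 1}"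
    by (intro closed_Collect_eq continuous_intros continuous_on_product_coordinates)
  ultimately have "compact S"
    unfolding S_def by (rule compact_Int_closed)
  have norm1: "f \<in> S" if "\<And>i. i \<ge> ?n \<Longrightarrow> f i = 0" "(\<Sum>i<?n. (f i)\<^sup>2) = 1" for f
  proof -
    have "\<bar>f i\<bar> \<le> 1" if "i < ?n" for i
    proof -
      have "(f i)\<^sup>2 \<le> (\<Sum>i<?n. (f i)\<^sup>2)"
        using \<open>i < ?n\<close> by (intro member_le_sum) auto
      then show ?thesis
        using \<open>(\<Sum>i<?n. (f i)\<^sup>2) = 1\<close> by (simp add: abs_square_le_1)
    qed
    then show ?thesis
      using that by (auto simp: S_def B_def abs_le_iff)
  qed
  have "(\<Sum>i<?n. (if i = 0 then 1 else 0 :: real)\<^sup>2) = (\<Sum>i<?n. if i = 0 then 1 else 0)"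
    by (intro sum.cong) auto
  then have "(\<lambda>i. if i = 0 then 1 else 0) \<in> S"
    using n by (intro norm1) auto
  then have "S \<noteq> {}" by auto
  then obtain f where f: "f \<in> S" and max: "\<And>g. g \<in> S \<Longrightarrow> quad_form M g \<le> quad_form M f"
    using continuous_attains_sup[OF \<open>compact S\<close> _ continuous_on_quad_form] by metis
  have "quad_form M g \<le> quad_form M f * (\<Sum>i<?n. (g i)\<^sup>2)" for g
  proof (cases "(\<Sum>i<?n. (g i)\<^sup>2) = 0")
    case True
    then have "\<forall>i<?n. g i = 0"
      by (subst (asm) sum_nonneg_eq_0_iff) auto
    then have "quad_form M g = 0"
      by (simp add: quad_form_def)
    then show ?thesis using True by simp
  next
    case False
    define s where "s = (\<Sum>i<?n. (g i)\<^sup>2)"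
    have s: "s > 0"
      using False unfolding s_def by (metis order_le_less sum_nonneg zero_le_power2)
    define h where "h = (\<lambda>i. if i < ?n then g i / sqrt s else 0)"
    have "(\<Sum>i<?n. (h i)\<^sup>2) = (\<Sum>i<?n. (g i)\<^sup>2 / s)"
      using s by (intro sum.cong) (auto simp: h_def power_divide)
    also have "\<dots> = 1"
      using s by (simp flip: sum_divide_distrib s_def)
    finally have "h \<in> S"
      by (intro norm1) (auto simp: h_def)
    then have "quad_form M h \<le> quad_form M f" by (rule max)
    moreover have "quad_form M g = s * quad_form M h"
    proof -
      have "quad_form M g = quad_form M (\<lambda>i. sqrt s * h i)"
        using s unfolding quad_form_def by (intro sum.cong) (auto simp: h_def)
      then show ?thesis
        using s by (simp add: quad_form_scale)
    qed
    ultimately show ?thesis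
      using s by (simp add: s_def mult.commute)
  qed
  then show thesis
    using that f by (auto simp: S_def)
qed

lemma quadratic_nonpos_imp_linear_zero:
  fixes a b :: real
  assumes "\<And>t. 2 * t * a + t\<^sup>2 * b \<le> 0"
  shows "a = 0"
proof (rule ccontr)
  assume "a \<noteq> 0"
  \<comment> \<open>for the step \<open>t = a / c\<close> the linear term dominates, since \<open>c\<close> exceeds \<open>\<bar>b\<bar>\<close>\<close>
  define c where "c = \<bar>b\<bar> + 1"
  have c: "c > 0" "- b < c" by (auto simp: c_def)
  have "2 * (a / c) * a + (a / c)\<^sup>2 * b = a\<^sup>2 * (2 * c + b) / c\<^sup>2"
    using c by (simp add: field_simps power2_eq_square)
  also have "\<dots> > 0"
    using c \<open>a \<noteq> 0\<close> by (intro divide_pos_pos mult_pos_pos) auto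
  finally show False
    using assms[of "a / c"] by simp
qed

text \<open>At a maximiser the derivative of \<open>quad_form M g - k * |g|\<^sup>2\<close> in each coordinate direction is
  zero, which is the eigenvalue equation.\<close>
lemma rayleigh_maximizer_eigen:
  assumes sym: "\<And>i j. i < dim_row M \<Longrightarrow> j < dim_row M \<Longrightarrow> M $$ (i, j) = M $$ (j, i)"
    and max: "\<And>g. quad_form M g \<le> k * (\<Sum>i<dim_row M. (g i)\<^sup>2)"
    and f: "quad_form M f = k * (\<Sum>i<dim_row M. (f i)\<^sup>2)"
    and l: "l < dim_row M"
  shows "(\<Sum>j<dim_row M. M $$ (l, j) * f j) = k * f l"
proof -
  let ?n = "dim_row M"
  define e where "e = (\<lambda>i. if i = l then 1 else 0 :: real)"
  define a where "a = (\<Sum>j<?n. M $$ (l, j) * f j)"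
  have "2 * t * (a - k * f l) + t\<^sup>2 * (M $$ (l, l) - k) \<le> 0" for t
  proof -
    have e_sum: "(\<Sum>i<?n. e i * h i) = h l" for h
      using l by (simp add: e_def if_distrib[of "\<lambda>x. x * _"] cong: if_cong)
    have "quad_form M (\<lambda>i. f i + t * e i)
        = (\<Sum>i<?n. \<Sum>j<?n. M $$ (i, j) * f i * f j + t * (e j * (M $$ (i, j) * f i))
            + t * (e i * (M $$ (i, j) * f j)) + t\<^sup>2 * (e i * (e j * M $$ (i, j))))"
      unfolding quad_form_def
      by (intro sum.cong refl) (simp add: algebra_simps power2_eq_square)
    also have "\<dots> = quad_form M f + t * (\<Sum>i<?n. M $$ (i, l) * f i) + t * a + t\<^sup>2 * M $$ (l, l)"
      by (simp add: sum.distrib e_sum a_def quad_form_def flip: sum_distrib_left)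
    also have "(\<Sum>i<?n. M $$ (i, l) * f i) = a"
      unfolding a_def using sym l by (intro sum.cong) auto
    finally have q: "quad_form M (\<lambda>i. f i + t * e i) = quad_form M f + 2 * t * a + t\<^sup>2 * M $$ (l, l)"
      by simp
    have "(\<Sum>i<?n. (f i + t * e i)\<^sup>2) = (\<Sum>i<?n. (f i)\<^sup>2 + e i * (2 * t * f i) + t\<^sup>2 * (e i * e i))"
      by (intro sum.cong refl) (simp add: algebra_simps power2_eq_square)
    also have "\<dots> = (\<Sum>i<?n. (f i)\<^sup>2) + 2 * t * f l + t\<^sup>2"
      by (simp add: sum.distrib e_sum flip: sum_distrib_left) (simp add: e_def)
    finally show ?thesis
      using max[of "\<lambda>i. f i + t * e i"] unfolding q f by (simp add: algebra_simps)
  qed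
  then have "a - k * f l = 0"
    by (rule quadratic_nonpos_imp_linear_zero)
  then show ?thesis by (simp add: a_def)
qed

text \<open>Where a nonnegative eigenvector vanishes, a sum of nonnegative terms vanishes, so the
  eigenvector vanishes at all neighbours too: its zero set is closed.\<close>
lemma irreducible_nonneg_kernel_zero:
  assumes irr: "irreducible_mat M"
    and nonneg: "\<And>i j. i < dim_row M \<Longrightarrow> j < dim_row M \<Longrightarrow> M $$ (i, j) \<ge> 0"
    and eig: "\<And>i. i < dim_row M \<Longrightarrow> (\<Sum>j<dim_row M. M $$ (i, j) * z j) = k * z i"
    and z: "\<And>i. i < dim_row M \<Longrightarrow> z i \<ge> (0::real)"
    and l: "l < dim_row M" "z l = 0" and i: "i < dim_row M"
  shows "z i = 0"
proof -
  let ?n = "dim_row M" and ?S = "{i. i < dim_row M \<and> z i = 0}"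
  have "M $$ (i, j) * z j = 0" if "i \<in> ?S" "j < ?n" for i j
  proof -
    have "(\<Sum>j<?n. M $$ (i, j) * z j) = 0"
      using eig that by auto
    then show ?thesis
      using that nonneg z by (subst (asm) sum_nonneg_eq_0_iff) auto
  qed
  then have "\<forall>i\<in>?S. \<forall>j<?n. M $$ (i, j) \<noteq> 0 \<longrightarrow> j \<in> ?S" by auto
  then have "?S = {..<?n}"
    using irr l unfolding irreducible_mat_def by (metis (mono_tags, lifting) CollectD CollectI emptyE lessThan_iff subsetI)
  then show ?thesis using i by auto
qed

section \<open>Multiplicity of an eigenvalue\<close>

text \<open>In a basis that starts with an eigenvector \<open>x\<close>, the first column of the matrix has a
  single nonzero entry. As \<open>x $ 0 \<noteq> 0\<close>, replacing the first vector of the standard basis by \<open>x\<close>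
  gives such a basis.\<close>
lemma deflation:
  fixes M :: "'a :: field mat"
  assumes M: "M \<in> carrier_mat (Suc n) (Suc n)"
    and x: "x \<in> carrier_vec (Suc n)" "x $ 0 \<noteq> 0" and eig: "M *\<^sub>v x = k \<cdot>\<^sub>v x"
  obtains P Q r N where "P \<in> carrier_mat (Suc n) (Suc n)" "Q \<in> carrier_mat (Suc n) (Suc n)"
    "r \<in> carrier_mat 1 n" "N \<in> carrier_mat n n"
    "P * Q = 1\<^sub>m (Suc n)" "Q * P = 1\<^sub>m (Suc n)" "P *\<^sub>v unit_vec (Suc n) 0 = x"
    "Q * M * P = four_block_mat (k \<cdot>\<^sub>m 1\<^sub>m 1) r (0\<^sub>m n 1) N"
proof -
  let ?m = "Suc n"
  define P where "P = mat ?m ?m (\<lambda>(i, j). if j = 0 then x $ i else if i = j then 1 else 0)"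
  have P: "P \<in> carrier_mat ?m ?m" by (simp add: P_def)
  \<comment> \<open>\<open>P\<close> is lower triangular with diagonal \<open>x $ 0, 1, \<dots>, 1\<close>, hence invertible\<close>
  have "det P = prod_list (diag_mat P)"
    by (rule det_lower_triangular[OF _ P]) (auto simp: P_def)
  also have "\<dots> \<noteq> 0"
    using x by (auto simp: prod_list_zero_iff diag_mat_def P_def)
  finally have "P \<in> Units (ring_mat TYPE('a) ?m ())"
    by (intro det_non_zero_imp_unit[OF P])
  then obtain Q where Q: "Q \<in> carrier_mat ?m ?m" and PQ: "P * Q = 1\<^sub>m ?m" and QP: "Q * P = 1\<^sub>m ?m"
    by (auto simp: Units_def ring_mat_def)
  have Pe: "P *\<^sub>v unit_vec ?m 0 = x"
    using x by (intro eq_vecI) (auto simp: P_def)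
  define B where "B = Q * M * P"
  have B: "B \<in> carrier_mat ?m ?m" using P Q M by (simp add: B_def)
  have "B *\<^sub>v unit_vec ?m 0 = Q *\<^sub>v (M *\<^sub>v (P *\<^sub>v unit_vec ?m 0))"
    unfolding B_def using P Q M by (simp add: assoc_mult_mat_vec[of _ ?m ?m _ ?m])
  also have "\<dots> = k \<cdot>\<^sub>v (Q *\<^sub>v (P *\<^sub>v unit_vec ?m 0))"
    using Q x by (simp add: Pe eig mult_mat_vec)
  also have "Q *\<^sub>v (P *\<^sub>v unit_vec ?m 0) = unit_vec ?m 0"
    using P Q by (simp add: QP flip: assoc_mult_mat_vec[of _ ?m ?m _ ?m])
  finally have Be: "B *\<^sub>v unit_vec ?m 0 = k \<cdot>\<^sub>v unit_vec ?m 0" .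
  have B0: "B $$ (i, 0) = (if i = 0 then k else 0)" if "i < ?m" for i
    using arg_cong[OF Be, of "\<lambda>v. v $ i"] that B by (auto split: if_splits)
  obtain B1 B2 B3 B4 where split: "split_block B 1 1 = (B1, B2, B3, B4)"
    by (metis prod_cases4)
  note sb = split_block[OF split, of n n]
  have carr: "B1 \<in> carrier_mat 1 1" "B2 \<in> carrier_mat 1 n" "B3 \<in> carrier_mat n 1" "B4 \<in> carrier_mat n n"
    and block: "B = four_block_mat B1 B2 B3 B4"
    using sb B by auto
  have "B1 = k \<cdot>\<^sub>m 1\<^sub>m 1"
  proof (rule eq_matI)
    fix i j assume "i < dim_row (k \<cdot>\<^sub>m 1\<^sub>m 1)" "j < dim_col (k \<cdot>\<^sub>m 1\<^sub>m 1)"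
    then show "B1 $$ (i, j) = (k \<cdot>\<^sub>m 1\<^sub>m 1) $$ (i, j)"
      using B0[of 0] carr by (simp add: block)
  qed (use carr in auto)
  moreover have "B3 = 0\<^sub>m n 1"
  proof (rule eq_matI)
    fix i j assume "i < dim_row (0\<^sub>m n 1)" "j < dim_col (0\<^sub>m n 1)"
    then show "B3 $$ (i, j) = 0\<^sub>m n 1 $$ (i, j)"
      using B0[of "Suc i"] carr by (simp add: block)
  qed (use carr in auto)
  ultimately show thesis
    using that[OF P Q carr(2,4) PQ QP Pe] block by (simp add: B_def)
qed

text \<open>Splitting off the factor \<open>X - k\<close> of the characteristic polynomial.\<close>
lemma deflation_char_poly:
  fixes M :: "'a :: field mat"
  assumes M: "M \<in> carrier_mat (Suc n) (Suc n)"
    and P: "P \<in> carrier_mat (Suc n) (Suc n)" and Q: "Q \<in> carrier_mat (Suc n) (Suc n)"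
    and r: "r \<in> carrier_mat 1 n" and N: "N \<in> carrier_mat n n"
    and PQ: "P * Q = 1\<^sub>m (Suc n)" and QP: "Q * P = 1\<^sub>m (Suc n)"
    and B: "Q * M * P = four_block_mat (k \<cdot>\<^sub>m 1\<^sub>m 1) r (0\<^sub>m n 1) N"
  shows "order k (char_poly M) = 1 \<longleftrightarrow> \<not> eigenvalue N k"
proof -
  let ?m = "Suc n"
  have "P * (Q * M * P) * Q = (P * Q) * M * (P * Q)"
    using P Q M by (simp add: assoc_mult_mat[of _ ?m ?m _ ?m _ ?m])
  then have "M = P * (Q * M * P) * Q"
    using M by (simp add: PQ)
  then have "similar_mat M (Q * M * P)"
    using P Q M PQ QP by (intro similar_matI[of _ _ P Q ?m]) auto
  then have "char_poly M = char_poly (k \<cdot>\<^sub>m 1\<^sub>m 1) * char_poly N"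
    using char_poly_similar B char_poly_four_block_zeros_col[OF _ r N] by fastforce
  also have "char_poly (k \<cdot>\<^sub>m 1\<^sub>m 1) = [:-k, 1:]"
    by (simp add: char_poly_defs det_def sign_def)
  finally have cp: "char_poly M = [:-k, 1:] * char_poly N" .
  have nz: "char_poly N \<noteq> 0"
    using degree_monic_char_poly[OF N] by auto
  then have "order k (char_poly M) = order k [:-k, 1:] + order k (char_poly N)"
    unfolding cp by (intro order_mult) (simp del: mult_pCons_left)
  also have "order k [:-k, 1:] = 1"
    using order_power_n_n[of k 1] by simp
  finally show ?thesis
    using nz by (simp add: eigenvalue_root_char_poly[OF N] order_root)
qed

text \<open>The geometric multiplicity is at most the algebraic one: if \<open>k\<close> is not an eigenvalue of
  the deflated matrix \<open>N\<close>, then an eigenvector has only its first coordinate in the new basis.\<close>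
lemma order_one_imp_eigenspace_line:
  fixes M :: "'a :: field mat"
  assumes M: "M \<in> carrier_mat n n" and n: "n > 0"
    and x: "x \<in> carrier_vec n" "x $ 0 \<noteq> 0" "M *\<^sub>v x = k \<cdot>\<^sub>v x"
    and ord: "order k (char_poly M) = 1"
    and y: "y \<in> carrier_vec n" "M *\<^sub>v y = k \<cdot>\<^sub>v y"
  shows "\<exists>c. y = c \<cdot>\<^sub>v x"
proof -
  obtain m where m: "n = Suc m"
    using n by (cases n) auto
  obtain P Q r N where P: "P \<in> carrier_mat n n" and Q: "Q \<in> carrier_mat n n"
    and r: "r \<in> carrier_mat 1 m" and N: "N \<in> carrier_mat m m"
    and PQ: "P * Q = 1\<^sub>m n" and QP: "Q * P = 1\<^sub>m n" and Pe: "P *\<^sub>v unit_vec n 0 = x"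
    and B: "Q * M * P = four_block_mat (k \<cdot>\<^sub>m 1\<^sub>m 1) r (0\<^sub>m m 1) N"
    using deflation[of M m x k] M x unfolding m by metis
  have not: "\<not> eigenvalue N k"
    using deflation_char_poly[of M m P Q r N k] M P Q r N PQ QP B ord unfolding m by simp
  define z where "z = Q *\<^sub>v y"
  define a where "a = vec_first z 1"
  define b where "b = vec_last z m"
  have z: "z \<in> carrier_vec n" using Q y by (simp add: z_def)
  have ab: "z = a @\<^sub>v b" "a \<in> carrier_vec 1" "b \<in> carrier_vec m"
    using z unfolding a_def b_def m by auto
  have Pz: "P *\<^sub>v z = y"
    using P Q y by (simp add: z_def PQ flip: assoc_mult_mat_vec[of _ n n _ n])
  have "(Q * M * P) *\<^sub>v z = Q *\<^sub>v (M *\<^sub>v (P *\<^sub>v z))"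
    using P Q M z by (simp add: assoc_mult_mat_vec[of _ n n _ n])
  also have "\<dots> = k \<cdot>\<^sub>v z"
    unfolding Pz using Q y by (simp add: mult_mat_vec z_def)
  finally have "four_block_mat (k \<cdot>\<^sub>m 1\<^sub>m 1) r (0\<^sub>m m 1) N *\<^sub>v (a @\<^sub>v b) = k \<cdot>\<^sub>v (a @\<^sub>v b)"
    by (simp only: B ab(1)[symmetric])
  moreover have "four_block_mat (k \<cdot>\<^sub>m 1\<^sub>m 1) r (0\<^sub>m m 1) N *\<^sub>v (a @\<^sub>v b)
      = ((k \<cdot>\<^sub>m 1\<^sub>m 1) *\<^sub>v a + r *\<^sub>v b) @\<^sub>v (0\<^sub>m m 1 *\<^sub>v a + N *\<^sub>v b)"
    using four_block_mat_mult_vec[of "k \<cdot>\<^sub>m 1\<^sub>m 1" 1 1 r m "0\<^sub>m m 1" m N a b] r N ab by simp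
  moreover have "0\<^sub>m m 1 *\<^sub>v a + N *\<^sub>v b = N *\<^sub>v b"
    using N ab by (intro eq_vecI) auto
  moreover have "k \<cdot>\<^sub>v (a @\<^sub>v b) = (k \<cdot>\<^sub>v a) @\<^sub>v (k \<cdot>\<^sub>v b)"
    by (intro eq_vecI) auto
  ultimately have "((k \<cdot>\<^sub>m 1\<^sub>m 1) *\<^sub>v a + r *\<^sub>v b) @\<^sub>v (N *\<^sub>v b) = (k \<cdot>\<^sub>v a) @\<^sub>v (k \<cdot>\<^sub>v b)"
    by (simp only:)
  moreover have "(k \<cdot>\<^sub>m 1\<^sub>m 1) *\<^sub>v a + r *\<^sub>v b \<in> carrier_vec 1"
    using r by (intro carrier_vecI) auto
  ultimately have "N *\<^sub>v b = k \<cdot>\<^sub>v b"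
    using append_vec_eq[of _ 1 "k \<cdot>\<^sub>v a" "N *\<^sub>v b" "k \<cdot>\<^sub>v b"] ab by simp
  then have b: "b = 0\<^sub>v m"
    using not ab N unfolding eigenvalue_def eigenvector_def by auto
  have "z = a $ 0 \<cdot>\<^sub>v unit_vec n 0"
    using ab b by (intro eq_vecI) (auto simp: m)
  then have "y = a $ 0 \<cdot>\<^sub>v x"
    using P by (simp flip: Pz Pe add: mult_mat_vec)
  then show ?thesis ..
qed

text \<open>If \<open>k\<close> were an eigenvalue of the deflated matrix \<open>N\<close>, a left eigenvector \<open>l\<close> of \<open>N\<close>, padded by
  a zero, would be a left eigenvector of the block matrix. Carried back it is a left eigenvector of
  \<open>M\<close>, hence by symmetry an eigenvector \<open>y\<close> of \<open>M\<close>, and the zero in front makes it orthogonal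
  to \<open>x\<close>; so it is not a multiple of \<open>x\<close>.\<close>
lemma symmetric_eigenspace_line_imp_order_one:
  fixes M :: "'a :: field mat"
  assumes M: "M \<in> carrier_mat n n" and n: "n > 0" and sym: "transpose_mat M = M"
    and x: "x \<in> carrier_vec n" "x $ 0 \<noteq> 0" "M *\<^sub>v x = k \<cdot>\<^sub>v x" "x \<bullet> x \<noteq> 0"
    and line: "\<And>y. y \<in> carrier_vec n \<Longrightarrow> M *\<^sub>v y = k \<cdot>\<^sub>v y \<Longrightarrow> \<exists>c. y = c \<cdot>\<^sub>v x"
  shows "order k (char_poly M) = 1"
proof -
  obtain m where m: "n = Suc m"
    using n by (cases n) auto
  obtain P Q r N where P: "P \<in> carrier_mat n n" and Q: "Q \<in> carrier_mat n n"
    and r: "r \<in> carrier_mat 1 m" and N: "N \<in> carrier_mat m m"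
    and PQ: "P * Q = 1\<^sub>m n" and QP: "Q * P = 1\<^sub>m n" and Pe: "P *\<^sub>v unit_vec n 0 = x"
    and B: "Q * M * P = four_block_mat (k \<cdot>\<^sub>m 1\<^sub>m 1) r (0\<^sub>m m 1) N"
    using deflation[of M m x k] M x unfolding m by metis
  have "\<not> eigenvalue N k"
  proof
    assume "eigenvalue N k"
    then have "eigenvalue (transpose_mat N) k"
      using N by (simp add: eigenvalue_root_char_poly[of _ m])
    then obtain l where l: "l \<in> carrier_vec m" "l \<noteq> 0\<^sub>v m" "transpose_mat N *\<^sub>v l = k \<cdot>\<^sub>v l"
      using N unfolding eigenvalue_def eigenvector_def by auto
    define w where "w = 0\<^sub>v 1 @\<^sub>v l"
    have w: "w \<in> carrier_vec n"
      unfolding w_def m using append_carrier_vec[OF zero_carrier_vec[of 1] l(1)] by simp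
    let ?B = "Q * M * P"
    have "transpose_mat ?B = four_block_mat (k \<cdot>\<^sub>m 1\<^sub>m 1) (0\<^sub>m 1 m) (transpose_mat r) (transpose_mat N)"
      unfolding B using r N by (subst transpose_four_block_mat[of _ 1 1 _ m _ m]) (auto intro!: eq_matI)
    then have "transpose_mat ?B *\<^sub>v w = ((k \<cdot>\<^sub>m 1\<^sub>m 1) *\<^sub>v 0\<^sub>v 1 + 0\<^sub>m 1 m *\<^sub>v l)
        @\<^sub>v (transpose_mat r *\<^sub>v 0\<^sub>v 1 + transpose_mat N *\<^sub>v l)"
      unfolding w_def using r N l by (simp add: four_block_mat_mult_vec[of _ 1 1 _ m _ m])
    also have "\<dots> = k \<cdot>\<^sub>v w"
    proof -
      have "(k \<cdot>\<^sub>m 1\<^sub>m 1) *\<^sub>v 0\<^sub>v 1 + 0\<^sub>m 1 m *\<^sub>v l = k \<cdot>\<^sub>v 0\<^sub>v 1"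
        using l by (intro eq_vecI) auto
      moreover have "transpose_mat r *\<^sub>v 0\<^sub>v 1 + transpose_mat N *\<^sub>v l = k \<cdot>\<^sub>v l"
        unfolding l(3) using r l by (intro eq_vecI) (auto simp: scalar_prod_def)
      moreover have "(k \<cdot>\<^sub>v 0\<^sub>v 1) @\<^sub>v (k \<cdot>\<^sub>v l) = k \<cdot>\<^sub>v (0\<^sub>v 1 @\<^sub>v l)"
        by (intro eq_vecI) auto
      ultimately show ?thesis
        unfolding w_def by (simp only:)
    qed
    finally have Bw: "transpose_mat ?B *\<^sub>v w = k \<cdot>\<^sub>v w" .
    define y where "y = transpose_mat Q *\<^sub>v w"
    have y: "y \<in> carrier_vec n" using Q w by (simp add: y_def)
    have B_carr: "?B \<in> carrier_mat n n" using P Q M by simp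
    have "?B * Q = Q * M * (P * Q)"
      using P Q M by (simp add: assoc_mult_mat[of _ n n _ n _ n])
    then have BQ: "?B * Q = Q * M" using M Q by (simp add: PQ)
    have "M *\<^sub>v y = transpose_mat (Q * M) *\<^sub>v w"
      unfolding y_def using M Q w
      by (simp add: transpose_mult[OF Q M] sym assoc_mult_mat_vec[of _ n n _ n])
    also have "transpose_mat (Q * M) = transpose_mat Q * transpose_mat ?B"
      using transpose_mult[OF B_carr Q] BQ by simp
    also have "\<dots> *\<^sub>v w = transpose_mat Q *\<^sub>v (transpose_mat ?B *\<^sub>v w)"
      using B_carr Q w by (intro assoc_mult_mat_vec[of _ n n _ n]) auto
    also have "\<dots> = k \<cdot>\<^sub>v y"
      unfolding Bw y_def using Q w by (simp add: mult_mat_vec)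
    finally obtain c where c: "y = c \<cdot>\<^sub>v x"
      using line y by blast
    have "y \<bullet> x = w \<bullet> (Q *\<^sub>v x)"
      unfolding y_def using transpose_vec_mult_scalar[OF Q x(1) w] by simp
    also have "Q *\<^sub>v x = unit_vec n 0"
      using P Q by (simp add: QP flip: Pe assoc_mult_mat_vec[of _ n n _ n])
    also have "w \<bullet> unit_vec n 0 = 0"
      using w n l by (simp add: w_def m)
    finally have "c = 0"
      using c x by simp
    then have "y = 0\<^sub>v n" using c x by auto
    have "w = transpose_mat (Q * P) *\<^sub>v w"
      using w by (simp add: QP)
    also have "\<dots> = transpose_mat P *\<^sub>v y"
      unfolding y_def using P Q w by (simp add: transpose_mult[of _ n n _ n] assoc_mult_mat_vec[of _ n n _ n])
    also have "\<dots> = 0\<^sub>v n"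
      using P \<open>y = 0\<^sub>v n\<close> by auto
    finally have "w = 0\<^sub>v 1 @\<^sub>v 0\<^sub>v m"
      by (auto simp: m intro!: eq_vecI)
    then have "l = 0\<^sub>v m"
      unfolding w_def using l append_vec_eq[of "0\<^sub>v 1" 1 "0\<^sub>v 1" l "0\<^sub>v m"] by simp
    then show False using l by simp
  qed
  then show ?thesis
    using deflation_char_poly[of M m P Q r N k] M P Q r N PQ QP B unfolding m by simp
qed

section \<open>Perron-Frobenius for symmetric matrices\<close>

text \<open>By symmetry the complement of a closed set \<open>S\<close> is closed as well. So restricting the positive
  eigenvector to \<open>S\<close> gives another eigenvector, which is a multiple of the first only if \<open>S\<close>
  contains all indices.\<close>
lemma irreducible_if_simple_positive:
  assumes M: "M \<in> carrier_mat n n" and n: "n > 0" and sym: "transpose_mat M = M"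
    and simple: "simple_eigenvalue M k" and x: "eigenvector M x k" "positive_vec x"
  shows "irreducible_mat M"
  unfolding irreducible_mat_def
proof (intro allI impI)
  have Mx: "x \<in> carrier_vec n" "M *\<^sub>v x = k \<cdot>\<^sub>v x"
    using x M unfolding eigenvector_def by auto
  have pos: "x $ i > 0" if "i < n" for i
    using x Mx that by (auto simp: positive_vec_def)
  have dim: "dim_row M = n" using M by auto
  fix S assume S: "S \<subseteq> {..<dim_row M}" "S \<noteq> {}"
    and closed: "\<forall>i\<in>S. \<forall>j<dim_row M. M $$ (i, j) \<noteq> 0 \<longrightarrow> j \<in> S"
  have Msym: "M $$ (i, j) = M $$ (j, i)" if "i < n" "j < n" for i j
    using M that index_transpose_mat(1)[of i M j] unfolding sym by auto
  define y where "y = vec n (\<lambda>i. if i \<in> S then x $ i else 0)"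
  have y: "y \<in> carrier_vec n" by (simp add: y_def)
  have "M *\<^sub>v y = k \<cdot>\<^sub>v y"
  proof (rule eq_vecI)
    fix i assume "i < dim_vec (k \<cdot>\<^sub>v y)"
    then have i: "i < n" by (simp add: y_def)
    have "(M *\<^sub>v y) $ i = (\<Sum>j<n. M $$ (i, j) * y $ j)"
      by (rule mult_mat_vec_index[OF M y i])
    also have "\<dots> = (\<Sum>j<n. if i \<in> S then M $$ (i, j) * x $ j else 0)"
      \<comment> \<open>entries across the border of \<open>S\<close> vanish in both directions\<close>
    proof (intro sum.cong refl)
      fix j assume "j \<in> {..<n}"
      then have "j < n" by simp
      then have "i \<in> S \<longleftrightarrow> j \<in> S" if "M $$ (i, j) \<noteq> 0"
        using closed that i Msym[OF i \<open>j < n\<close>] unfolding dim by metis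
      then show "M $$ (i, j) * y $ j = (if i \<in> S then M $$ (i, j) * x $ j else 0)"
        using \<open>j < n\<close> by (cases "M $$ (i, j) = 0") (auto simp: y_def)
    qed
    also have "\<dots> = (if i \<in> S then (M *\<^sub>v x) $ i else 0)"
      using mult_mat_vec_index[OF M Mx(1) i] by simp
    also have "\<dots> = (k \<cdot>\<^sub>v y) $ i"
      using i Mx by (simp add: y_def)
    finally show "(M *\<^sub>v y) $ i = (k \<cdot>\<^sub>v y) $ i" .
  qed (use M in \<open>simp add: y_def\<close>)
  then obtain c where c: "y = c \<cdot>\<^sub>v x"
    using order_one_imp_eigenspace_line[OF M n Mx(1) _ Mx(2) _ y] pos[of 0] n simple
    unfolding simple_eigenvalue_def by auto
  have yc: "(if i \<in> S then x $ i else 0) = c * x $ i" if "i < n" for i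
    using arg_cong[OF c, of "\<lambda>v. v $ i"] that Mx by (simp add: y_def)
  obtain s where s: "s \<in> S" "s < n"
    using S dim by auto
  then have "c = 1"
    using yc[of s] pos[of s] by simp
  then have "i \<in> S" if "i < n" for i
    using yc[of i] pos[of i] that by (auto split: if_splits)
  then show "S = {..<dim_row M}"
    using S dim by auto
qed

text \<open>Taking absolute values does not decrease the quadratic form of a nonnegative matrix, so
  some maximiser \<open>h\<close> is nonnegative, and irreducibility makes it positive. For another
  eigenvector \<open>y\<close>, subtract the largest multiple of \<open>h\<close> that leaves the difference nonnegative:
  the difference vanishes somewhere, hence everywhere.\<close>
lemma irreducible_imp_simple_positive:
  assumes M: "M \<in> carrier_mat n n" and n: "n > 0" and sym: "transpose_mat M = M"
    and nonneg: "\<And>i j. i < n \<Longrightarrow> j < n \<Longrightarrow> M $$ (i, j) \<ge> 0"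
    and irr: "irreducible_mat M"
  shows "simple_eigenvalue M (largest_eigenvalue M)"
    and "\<exists>x. eigenvector M x (largest_eigenvalue M) \<and> positive_vec x"
proof -
  have dim: "dim_row M = n" using M by auto
  have Msym: "M $$ (i, j) = M $$ (j, i)" if "i < n" "j < n" for i j
    using M that index_transpose_mat(1)[of i M j] unfolding sym by auto
  obtain f where f1: "(\<Sum>i<n. (f i)\<^sup>2) = 1"
    and max: "\<And>g. quad_form M g \<le> quad_form M f * (\<Sum>i<n. (g i)\<^sup>2)"
    using rayleigh_maximizer[of M] n unfolding dim by auto
  define k where "k = quad_form M f"
  define h where "h = (\<lambda>i. \<bar>f i\<bar>)"
  have h1: "(\<Sum>i<n. (h i)\<^sup>2) = 1" using f1 by (simp add: h_def)
  have "k \<le> quad_form M h"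
    unfolding k_def quad_form_def h_def dim
  proof (intro sum_mono)
    fix i j assume "i \<in> {..<n}" "j \<in> {..<n}"
    then have "M $$ (i, j) \<ge> 0" using nonneg by auto
    then have "M $$ (i, j) * (f i * f j) \<le> M $$ (i, j) * (\<bar>f i\<bar> * \<bar>f j\<bar>)"
      by (intro mult_left_mono) (simp flip: abs_mult)
    then show "M $$ (i, j) * f i * f j \<le> M $$ (i, j) * \<bar>f i\<bar> * \<bar>f j\<bar>"
      by (simp add: mult.assoc)
  qed
  then have "quad_form M h = k"
    using max[of h] h1 by (simp add: k_def)
  then have h_eig: "(\<Sum>j<n. M $$ (i, j) * h j) = k * h i" if "i < n" for i
    using rayleigh_maximizer_eigen[of M k h i] Msym max that h1 by (simp add: dim k_def)
  have h_pos: "h i > 0" if i: "i < n" for i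
  proof (rule ccontr)
    assume "\<not> h i > 0"
    then have "h i = 0" by (simp add: h_def)
    then have "h j = 0" if "j < n" for j
      using irreducible_nonneg_kernel_zero[OF irr, of h k i j] nonneg h_eig i that
      by (simp add: dim h_def)
    then show False using h1 by simp
  qed
  define x where "x = vec n h"
  have x: "x \<in> carrier_vec n" by (simp add: x_def)
  have Mx: "M *\<^sub>v x = k \<cdot>\<^sub>v x"
  proof (rule eq_vecI)
    fix i assume "i < dim_vec (k \<cdot>\<^sub>v x)"
    then have i: "i < n" by (simp add: x_def)
    then show "(M *\<^sub>v x) $ i = (k \<cdot>\<^sub>v x) $ i"
      using mult_mat_vec_index[OF M x i] h_eig[OF i] by (simp add: x_def)
  qed (use M x in auto)
  have "x $ 0 > 0" using h_pos n by (simp add: x_def)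
  then have x_ev: "eigenvector M x k"
    using x Mx M n unfolding eigenvector_def by auto
  have pos: "positive_vec x"
    using h_pos by (simp add: positive_vec_def x_def)
  have top: "l \<le> k" if ev: "eigenvalue M l" for l
  proof -
    obtain y where y: "y \<in> carrier_vec n" "y \<noteq> 0\<^sub>v n" "M *\<^sub>v y = l \<cdot>\<^sub>v y"
      using ev M unfolding eigenvalue_def eigenvector_def by auto
    have "quad_form M (\<lambda>i. y $ i) = (\<Sum>i<n. y $ i * (\<Sum>j<n. M $$ (i, j) * y $ j))"
      by (simp add: quad_form_def dim sum_distrib_left mult_ac)
    also have "\<dots> = (\<Sum>i<n. l * (y $ i)\<^sup>2)"
      using y M mult_mat_vec_index[OF M y(1), symmetric]
      by (intro sum.cong refl) (auto simp: power2_eq_square)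
    finally have "l * (\<Sum>i<n. (y $ i)\<^sup>2) \<le> k * (\<Sum>i<n. (y $ i)\<^sup>2)"
      using max[of "\<lambda>i. y $ i"] by (simp add: sum_distrib_left k_def)
    moreover have "(\<Sum>i<n. (y $ i)\<^sup>2) > 0"
    proof -
      obtain i where "i < n" "y $ i \<noteq> 0"
        using y by (metis carrier_vecD eq_vecI index_zero_vec)
      then show ?thesis by (intro sum_pos2[of _ i]) auto
    qed
    ultimately show ?thesis by simp
  qed
  have "k \<in> spectrum M"
    using x_ev by (auto simp: spectrum_def eigenvalue_def)
  then have largest: "largest_eigenvalue M = k"
    unfolding largest_eigenvalue_def using card_finite_spectrum(1)[OF M] top
    by (intro Max_eqI) (auto simp: spectrum_def)
  have "\<exists>c. y = c \<cdot>\<^sub>v x" if y: "y \<in> carrier_vec n" "M *\<^sub>v y = k \<cdot>\<^sub>v y" for y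
  proof -
    define c where "c = Min ((\<lambda>i. y $ i / h i) ` {..<n})"
    have "c \<in> (\<lambda>i. y $ i / h i) ` {..<n}"
      unfolding c_def using n by (intro Min_in) auto
    then obtain l where l: "l < n" "c = y $ l / h l" by auto
    have le: "c \<le> y $ i / h i" if "i < n" for i
      unfolding c_def using that by (intro Min_le) auto
    define z where "z = (\<lambda>i. y $ i - c * h i)"
    have "z i \<ge> 0" if "i < n" for i
      using le[OF that] h_pos[OF that] by (simp add: z_def field_simps)
    moreover have "z l = 0"
      using l h_pos[of l] by (simp add: z_def)
    moreover have "(\<Sum>j<n. M $$ (i, j) * z j) = k * z i" if i: "i < n" for i
    proof -
      have "(\<Sum>j<n. M $$ (i, j) * z j)
          = (\<Sum>j<n. M $$ (i, j) * y $ j) - c * (\<Sum>j<n. M $$ (i, j) * h j)"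
        by (simp add: z_def algebra_simps sum_subtractf sum_distrib_left)
      then show ?thesis
        using mult_mat_vec_index[OF M y(1) i] y i h_eig[OF i]
        by (simp add: z_def algebra_simps)
    qed
    ultimately have "z i = 0" if "i < n" for i
      using irreducible_nonneg_kernel_zero[OF irr, of z k l i] nonneg l that by (simp add: dim)
    then have "y = c \<cdot>\<^sub>v x"
      using y by (intro eq_vecI) (auto simp: z_def x_def)
    then show ?thesis ..
  qed
  moreover have "x \<bullet> x \<noteq> 0"
    using h1 by (simp add: scalar_prod_def x_def power2_eq_square atLeast0LessThan)
  ultimately have "order k (char_poly M) = 1"
    using symmetric_eigenspace_line_imp_order_one[OF M n sym x _ Mx] \<open>x $ 0 > 0\<close> by simp
  then show "simple_eigenvalue M (largest_eigenvalue M)"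
    using x_ev unfolding largest simple_eigenvalue_def eigenvalue_def by blast
  show "\<exists>x. eigenvector M x (largest_eigenvalue M) \<and> positive_vec x"
    using x_ev pos unfolding largest by blast
qed

section \<open>The integrated adjacency matrix of the lift\<close>

text \<open>Row \<open>i\<close> of the integrated adjacency matrix belongs to this vertex of the lift; the
  remainder undoes the offset of the lower half.\<close>
definition lift_vertex :: "'v list \<Rightarrow> nat \<Rightarrow> 'v \<times> bool" where
  "lift_vertex vs i = (vs ! (i mod length vs), i < length vs)"

lemma bij_betw_lift_vertex:
  assumes "distinct vs"
  shows "bij_betw (lift_vertex vs) {..<2 * length vs} (set vs \<times> UNIV)"
proof (rule bij_betw_imageI)
  let ?n = "length vs"
  have mod: "i mod ?n = (if i < ?n then i else i - ?n)" if "i < 2 * ?n" for i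
    using that by (simp add: le_mod_geq)
  have mod_less: "i mod ?n < ?n" if "i < 2 * ?n" for i
    using that by (intro mod_less_divisor) auto
  show "inj_on (lift_vertex vs) {..<2 * ?n}"
  proof (rule inj_onI)
    fix i j assume ij: "i \<in> {..<2 * ?n}" "j \<in> {..<2 * ?n}" "lift_vertex vs i = lift_vertex vs j"
    then have "i mod ?n = j mod ?n" "i < ?n \<longleftrightarrow> j < ?n"
      using assms mod_less by (auto simp: lift_vertex_def nth_eq_iff_index_eq)
    then show "i = j" using mod[of i] mod[of j] ij by (auto split: if_splits)
  qed
  show "lift_vertex vs ` {..<2 * ?n} = set vs \<times> UNIV"
  proof (rule subset_antisym; rule subsetI)
    fix x assume "x \<in> lift_vertex vs ` {..<2 * ?n}"
    then show "x \<in> set vs \<times> UNIV" using mod_less by (auto simp: lift_vertex_def)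
  next
    fix x :: "'a \<times> bool" assume "x \<in> set vs \<times> UNIV"
    then obtain i where i: "i < ?n" "fst x = vs ! i"
      by (auto simp: in_set_conv_nth)
    show "x \<in> lift_vertex vs ` {..<2 * ?n}"
    proof (cases "snd x")
      case True
      with i show ?thesis
        by (intro image_eqI[of _ _ i]) (auto simp: lift_vertex_def prod_eq_iff)
    next
      case False
      with i show ?thesis
        by (intro image_eqI[of _ _ "i + ?n"]) (auto simp: lift_vertex_def prod_eq_iff)
    qed
  qed
qed

lemma integrated_adj_mat_carrier:
  "integrated_adj_mat G vs \<in> carrier_mat (2 * length vs) (2 * length vs)"
  by (simp add: integrated_adj_mat_def adj_mat_def arc_mat_def mult_2)

lemma transpose_integrated_adj_mat:
  "transpose_mat (integrated_adj_mat G vs) = integrated_adj_mat G vs"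
proof -
  let ?n = "length vs"
  have A: "adj_mat G vs \<in> carrier_mat ?n ?n" and D: "arc_mat G vs \<in> carrier_mat ?n ?n"
    by (simp_all add: adj_mat_def arc_mat_def)
  have "Upair x y = Upair y x" for x y :: 'a by auto
  then have "card {e \<in> edges G. ends G e = Upair x y} = card {e \<in> edges G. ends G e = Upair y x}" for x y
    by metis
  then have "transpose_mat (adj_mat G vs) = adj_mat G vs"
    by (intro eq_matI) (auto simp: adj_mat_def simp del: Upair_inject)
  then show ?thesis
    unfolding integrated_adj_mat_def using transpose_four_block_mat[OF A D _ A] D by simp
qed

lemma integrated_adj_mat_entry:
  assumes G: "mixed_graph G" and ij: "i < 2 * length vs" "j < 2 * length vs"
  shows "integrated_adj_mat G vs $$ (i, j) \<ge> 0"
    and "integrated_adj_mat G vs $$ (i, j) \<noteq> 0 \<longleftrightarrow>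
      lift_adj G (lift_vertex vs i) (lift_vertex vs j)"
proof -
  let ?n = "length vs"
  define u where "u = vs ! (i mod ?n)"
  define w where "w = vs ! (j mod ?n)"
  have mod: "k mod ?n = (if k < ?n then k else k - ?n)" if "k < 2 * ?n" for k
    using that by (simp add: le_mod_geq)
  have card_pos: "card {x \<in> A. P x} \<noteq> 0 \<longleftrightarrow> (\<exists>x\<in>A. P x)" if "finite A" for A :: "'x set" and P
    using that by auto
  have entry: "integrated_adj_mat G vs $$ (i, j) =
    (if (i < ?n) = (j < ?n) then (if i = j then 2 else 1) * real (card {e \<in> edges G. ends G e = Upair u w})
     else if i < ?n then real (card {a \<in> arcs G. tail G a = u \<and> head G a = w})
     else real (card {a \<in> arcs G. tail G a = w \<and> head G a = u}))"
    using ij mod[OF ij(1)] mod[OF ij(2)]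
    by (auto simp: integrated_adj_mat_def adj_mat_def arc_mat_def u_def w_def)
  then show "integrated_adj_mat G vs $$ (i, j) \<ge> 0" by auto
  have fin: "finite (edges G)" "finite (arcs G)"
    using G by (auto simp: mixed_graph_def)
  have "lift_adj G (u, i < ?n) (w, j < ?n) \<longleftrightarrow>
    (if (i < ?n) = (j < ?n) then \<exists>e\<in>edges G. ends G e = Upair u w
     else if i < ?n then \<exists>a\<in>arcs G. tail G a = u \<and> head G a = w
     else \<exists>a\<in>arcs G. tail G a = w \<and> head G a = u)"
    unfolding lift_adj_def arc_end_def by (cases "i < ?n"; cases "j < ?n") auto
  then show "integrated_adj_mat G vs $$ (i, j) \<noteq> 0 \<longleftrightarrow>
      lift_adj G (lift_vertex vs i) (lift_vertex vs j)"
    unfolding entry lift_vertex_def u_def[symmetric] w_def[symmetric]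
    using card_pos[OF fin(1)] card_pos[OF fin(2)] by simp
qed

lemma irreducible_integrated_adj_mat_iff_uniconnected:
  assumes G: "mixed_graph G" and vs: "distinct vs" "set vs = verts G"
  shows "irreducible_mat (integrated_adj_mat G vs) \<longleftrightarrow> uniconnected G"
proof -
  let ?M = "integrated_adj_mat G vs" and ?N = "2 * length vs" and ?f = "lift_vertex vs"
  have dim: "dim_row ?M = ?N" using integrated_adj_mat_carrier[of G vs] by auto
  have bij: "bij_betw ?f {..<?N} (verts G \<times> UNIV)"
    using bij_betw_lift_vertex[OF vs(1)] vs(2) by simp
  have inj: "inj_on ?f {..<?N}" and img: "?f ` {..<?N} = verts G \<times> UNIV"
    using bij by (auto simp: bij_betw_def)
  have closed_iff: "(\<forall>i\<in>S. \<forall>j<?N. ?M $$ (i, j) \<noteq> 0 \<longrightarrow> j \<in> S) \<longleftrightarrow>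
      (\<forall>x\<in>?f ` S. \<forall>y. lift_adj G x y \<longrightarrow> y \<in> ?f ` S)" if S: "S \<subseteq> {..<?N}" for S
  proof -
    have "(\<forall>j<?N. ?M $$ (i, j) \<noteq> 0 \<longrightarrow> j \<in> S) \<longleftrightarrow> (\<forall>y. lift_adj G (?f i) y \<longrightarrow> y \<in> ?f ` S)"
      if "i \<in> S" for i
    proof -
      have i: "i < ?N" using that S by auto
      have "(\<forall>y. lift_adj G (?f i) y \<longrightarrow> y \<in> ?f ` S) \<longleftrightarrow>
          (\<forall>y\<in>?f ` {..<?N}. lift_adj G (?f i) y \<longrightarrow> y \<in> ?f ` S)"
      proof -
        have "y \<in> verts G \<times> UNIV" if "lift_adj G (?f i) y" for y
          using lift_adj_verts(2)[OF G that] by (simp add: mem_Times_iff)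
        then show ?thesis unfolding img by blast
      qed
      also have "\<dots> \<longleftrightarrow> (\<forall>j<?N. lift_adj G (?f i) (?f j) \<longrightarrow> j \<in> S)"
        using inj_on_image_mem_iff[OF inj _ S] by auto
      finally show ?thesis
        using integrated_adj_mat_entry(2)[OF G i] by auto
    qed
    then show ?thesis by auto
  qed
  have "irreducible_mat ?M \<longleftrightarrow> (\<forall>S \<subseteq> {..<?N}. ?f ` S \<noteq> {} \<longrightarrow>
      (\<forall>x\<in>?f ` S. \<forall>y. lift_adj G x y \<longrightarrow> y \<in> ?f ` S) \<longrightarrow> ?f ` S = verts G \<times> UNIV)"
    unfolding irreducible_mat_def dim img[symmetric]
    using closed_iff inj_on_image_eq_iff[OF inj _ subset_refl] by auto
  also have "\<dots> \<longleftrightarrow> uniconnected G"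
    unfolding uniconnected_iff_no_closed_set[OF G] img[symmetric] all_subset_image ..
  finally show ?thesis .
qed

theorem theorem6p4:
  fixes G :: "('v, 'e, 'a) mixed_graph" and vs :: "'v list"
  assumes "simple_mixed_graph G"
    and "distinct vs" and "set vs = verts G"
  defines "M \<equiv> integrated_adj_mat G vs"
  shows "uniconnected G \<longleftrightarrow>
    simple_eigenvalue M (largest_eigenvalue M) \<and>
    (\<exists>x. eigenvector M x (largest_eigenvalue M) \<and> positive_vec x)"
proof -
  have G: "mixed_graph G" using assms(1) by (simp add: simple_mixed_graph_def)
  then have n: "2 * length vs > 0" using assms(3) by (auto simp: mixed_graph_def)
  have M: "M \<in> carrier_mat (2 * length vs) (2 * length vs)" and sym: "transpose_mat M = M"
    unfolding M_def by (rule integrated_adj_mat_carrier, rule transpose_integrated_adj_mat)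
  have nonneg: "M $$ (i, j) \<ge> 0" if "i < 2 * length vs" "j < 2 * length vs" for i j
    unfolding M_def using integrated_adj_mat_entry(1)[OF G that] .
  have "uniconnected G \<longleftrightarrow> irreducible_mat M"
    unfolding M_def using irreducible_integrated_adj_mat_iff_uniconnected[OF G assms(2,3)] by simp
  also have "\<dots> \<longleftrightarrow> simple_eigenvalue M (largest_eigenvalue M) \<and>
    (\<exists>x. eigenvector M x (largest_eigenvalue M) \<and> positive_vec x)"
    using irreducible_imp_simple_positive[OF M n sym nonneg]
      irreducible_if_simple_positive[OF M n sym] by blast
  finally show ?thesis .
qed

end
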